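(* Let $\mathcal{K}$ be an algebraically closed field of characteristic $0$, and let $V\subseteq\mathcal{K}^m$ be an irreducible variety with $\dim V=1$ that is not an affine line. Then $$\omega\big(\mathrm{Cay}(\mathcal{K}^m,\pm V)\big)<\infty.$$
   Context: $\pm V=V\cup(-V)$. $\mathrm{Cay}(\mathcal{K}^m,\pm V)$ is the graph with vertex set $\mathcal{K}^m$ in which distinct $x,y$ are adjacent iff $x-y\in\pm V$. The clique number $\omega(\mathcal{G})$ of a graph $\mathcal{G}$ is the largest $n$ for which $\mathcal{G}$ contains a complete subgraph on $n$ vertices. *)

theory Defs
  imports
    "HOL-Analysis.Cartesian_Space"
    "HOL-Computational_Algebra.Polynomial"
    "HOL-Library.Poly_Mapping"
    "HOL-Library.Extended_Nat"
    "Graph_Theory.Kuratowski"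
begin

section \<open>Affine algebraic sets\<close>

text \<open>
  Polynomials over \<open>'k\<close> in variables indexed by \<open>'m\<close>: finitely supported maps from exponent
  vectors \<open>'m \<Rightarrow>\<^sub>0 nat\<close> to coefficients.
\<close>

type_synonym ('m, 'k) mpoly = "('m \<Rightarrow>\<^sub>0 nat) \<Rightarrow>\<^sub>0 'k"

definition mpoly_eval :: "('m::finite, 'k::comm_ring_1) mpoly \<Rightarrow> 'k ^ 'm \<Rightarrow> 'k" where
  "mpoly_eval p x =
     (\<Sum>e\<in>Poly_Mapping.keys p.
        Poly_Mapping.lookup p e * (\<Prod>i\<in>UNIV. (x $ i) ^ Poly_Mapping.lookup e i))"

definition zero_locus :: "('m::finite, 'k::comm_ring_1) mpoly set \<Rightarrow> ('k ^ 'm) set" where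
  "zero_locus P = {x. \<forall>p\<in>P. mpoly_eval p x = 0}"

definition zariski_closed :: "('k::comm_ring_1 ^ 'm::finite) set \<Rightarrow> bool" where
  "zariski_closed X \<longleftrightarrow> (\<exists>P. X = zero_locus P)"

definition irreducible_variety :: "('k::comm_ring_1 ^ 'm::finite) set \<Rightarrow> bool" where
  "irreducible_variety X \<longleftrightarrow>
     zariski_closed X \<and> X \<noteq> {} \<and>
     (\<forall>A B. zariski_closed A \<and> zariski_closed B \<and> X = A \<union> B \<longrightarrow> X = A \<or> X = B)"

text \<open>
  Krull dimension: the supremum of the lengths \<open>n\<close> of chains
  \<open>Z 0 \<subset> Z 1 \<subset> \<dots> \<subset> Z n\<close> of irreducible closed subsets.  As \<open>enat\<close> has no \<open>-\<infinity>\<close>, the empty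
  set gets the value 0.
\<close>

definition variety_dim :: "('k::comm_ring_1 ^ 'm::finite) set \<Rightarrow> enat" where
  "variety_dim X =
     Sup {enat n | n. \<exists>Z :: nat \<Rightarrow> ('k ^ 'm) set.
            (\<forall>i\<le>n. irreducible_variety (Z i) \<and> Z i \<subseteq> X) \<and> (\<forall>i<n. Z i \<subset> Z (Suc i))}"

definition affine_line :: "('k::field ^ 'm::finite) set \<Rightarrow> bool" where
  "affine_line L \<longleftrightarrow> (\<exists>a v. v \<noteq> 0 \<and> L = {a + t *s v | t. True})"


section \<open>Cayley graphs and clique number\<close>

definition pm_set :: "'a::group_add set \<Rightarrow> 'a set" where
  "pm_set V = V \<union> uminus ` V"

text \<open>
  Undirected graphs are represented as symmetric loop-free digraphs; for \<open>S = pm_set V\<close> the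
  arc relation is symmetric.
\<close>

definition cayley_graph :: "'a::group_add set \<Rightarrow> 'a pair_pre_digraph" where
  "cayley_graph S = \<lparr> pverts = UNIV, parcs = {(x, y). x \<noteq> y \<and> x - y \<in> S} \<rparr>"

text \<open>
  In \<open>enat\<close>, the supremum is the largest such \<open>n\<close> if one exists, and \<open>\<infinity>\<close> otherwise.
\<close>

definition clique_number :: "('a, 'b) pre_digraph \<Rightarrow> enat" where
  "clique_number G = Sup {enat n | n. \<exists>H. subgraph H G \<and> complete_digraph n H}"

end

(* If u is nonzero, V is not contained in V + u: otherwise V contains p - k u for all natural k, hence
   the whole line p + K u, hence equals it.  So some defining polynomial f of V has a translate f(x - u)
   that is not identically zero on V, and V \<inter> (V + u) lies among its zeros.  Their number is
   bounded uniformly in u: by a Chevalley argument any two coordinates are algebraically dependent on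
   V (an irreducible closed set with finite proper closed subsets), so the functions of degree at
   most d on V form a space whose dimension grows linearly in d; if f had N zeros on V with Lagrange
   functions h_1, ..., h_N, the functions h_i f^l would be too many independent ones.  Finally, three
   vertices of a clique and the pigeonhole principle on signs place all further vertices in six such
   intersections. *)

theory Submission
  imports Defs
begin

section \<open>Polynomial functions\<close>

text \<open>Dimension 1 makes each V \<inter> (V + u) finite; the obstacle is a bound independent of
  u. Bezout's theorem would supply it; the growth of function spaces takes its place. Independence
  of u has two sources: V has finitely many defining polynomials (Hilbert's basis theorem), and
  translating a polynomial does not raise its degree. The second difficulty is that dimension is
  given by chains of closed sets, which say nothing directly about algebraic dependence. Lifting
  generic points of a projection bridges the gap: independent coordinates would produce an infinite
  fibre x_i = c, although such a fibre is a proper closed subset. Other coordinates need not be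
  integral over the chosen one, so denominators are cleared instead of passing to a Noether
  normalization. Characteristic 0 makes the points p - k u distinct; algebraic closedness supplies
  the root in the lifting step. Polynomials are treated as functions, since only their zeros matter;
  \<open>Pol U\<close> records the variables in use, so that the theorems of Hilbert and Chevalley
  can be proved by adding one variable at a time.\<close>

inductive_set Pol :: "'m set \<Rightarrow> ('k::field ^ 'm::finite \<Rightarrow> 'k) set" for U :: "'m set" where
  Pol_const: "(\<lambda>_. c) \<in> Pol U"
| Pol_var: "i \<in> U \<Longrightarrow> (\<lambda>x. x $ i) \<in> Pol U"
| Pol_add: "f \<in> Pol U \<Longrightarrow> g \<in> Pol U \<Longrightarrow> (\<lambda>x. f x + g x) \<in> Pol U"
| Pol_mult: "f \<in> Pol U \<Longrightarrow> g \<in> Pol U \<Longrightarrow> (\<lambda>x. f x * g x) \<in> Pol U"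

lemma Pol_uminus: "f \<in> Pol U \<Longrightarrow> (\<lambda>x. - f x) \<in> Pol U"
  using Pol_mult[OF Pol_const[of "-1"], of f U] by simp

lemma Pol_diff: "f \<in> Pol U \<Longrightarrow> g \<in> Pol U \<Longrightarrow> (\<lambda>x. f x - g x) \<in> Pol U"
  using Pol_add[OF _ Pol_uminus, of f U g] by simp

lemma Pol_sum: "(\<And>a. a \<in> A \<Longrightarrow> f a \<in> Pol U) \<Longrightarrow> (\<lambda>x. \<Sum>a\<in>A. f a x) \<in> Pol U"
  by (induction A rule: infinite_finite_induct) (auto intro: Pol_const Pol_add)

lemma Pol_prod: "(\<And>a. a \<in> A \<Longrightarrow> f a \<in> Pol U) \<Longrightarrow> (\<lambda>x. \<Prod>a\<in>A. f a x) \<in> Pol U"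
  by (induction A rule: infinite_finite_induct) (auto intro: Pol_const Pol_mult)

lemma Pol_power: "f \<in> Pol U \<Longrightarrow> (\<lambda>x. f x ^ n) \<in> Pol U"
  by (induction n) (auto intro: Pol_const Pol_mult)

lemmas Pol_intros = Pol_const Pol_var Pol_add Pol_mult Pol_uminus Pol_diff Pol_sum Pol_prod Pol_power

lemma Pol_mono: "f \<in> Pol U \<Longrightarrow> U \<subseteq> W \<Longrightarrow> f \<in> Pol W"
  by (induction rule: Pol.induct) (auto intro: Pol_intros)

lemma Pol_poly: "f \<in> Pol U \<Longrightarrow> (\<lambda>x. poly p (f x)) \<in> Pol U"
  unfolding poly_altdef by (intro Pol_intros)

lemma Pol_cong: "f \<in> Pol U \<Longrightarrow> (\<And>i. i \<in> U \<Longrightarrow> x $ i = y $ i) \<Longrightarrow> f x = f y"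
  by (induction rule: Pol.induct) auto

lemma Pol_empty: "f \<in> Pol {} \<Longrightarrow> \<exists>c. f = (\<lambda>_. c)"
  by (induction rule: Pol.induct) auto

lemma Pol_singleton: "f \<in> Pol {i} \<Longrightarrow> \<exists>p. f = (\<lambda>x. poly p (x $ i))"
proof (induction rule: Pol.induct)
  case (Pol_const c)
  show ?case by (rule exI[of _ "[:c:]"]) simp
next
  case (Pol_var j)
  then show ?case by (intro exI[of _ "[:0, 1:]"]) simp
next
  case (Pol_add f g)
  then obtain p q where "f = (\<lambda>x. poly p (x $ i))" "g = (\<lambda>x. poly q (x $ i))" by blast
  then show ?case by (intro exI[of _ "p + q"]) simp
next
  case (Pol_mult f g)
  then obtain p q where "f = (\<lambda>x. poly p (x $ i))" "g = (\<lambda>x. poly q (x $ i))" by blast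
  then show ?case by (intro exI[of _ "p * q"]) simp
qed

lemma Pol_translate: "f \<in> Pol U \<Longrightarrow> (\<lambda>x. f (x - u)) \<in> Pol U"
  by (induction rule: Pol.induct) (auto intro: Pol_intros)

lemma Pol_on_line: "f \<in> Pol U \<Longrightarrow> \<exists>q. \<forall>s. f (a + s *s v) = poly q s"
proof (induction rule: Pol.induct)
  case (Pol_const c)
  show ?case by (rule exI[of _ "[:c:]"]) simp
next
  case (Pol_var j)
  then show ?case by (intro exI[of _ "[:a $ j, v $ j:]"]) simp
next
  case (Pol_add f g)
  then show ?case by (metis poly_add)
next
  case (Pol_mult f g)
  then show ?case by (metis poly_mult)
qed

lemma Pol_zero_on_line:
  assumes f: "f \<in> Pol U" and inf: "infinite {s. f (a + s *s v) = 0}"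
  shows "f (a + s *s v) = 0"
proof -
  obtain q where q: "\<And>s. f (a + s *s v) = poly q s"
    using Pol_on_line[OF f] by blast
  have "q = 0" using inf poly_roots_finite[of q] by (auto simp: q)
  then show ?thesis by (simp add: q)
qed

subsection \<open>Families of univariate polynomials\<close>

text \<open>A polynomial in one more variable over \<open>Pol U\<close> is encoded as a map from points to \<open>'k poly\<close>, so
  that the ring operations of \<open>'k poly\<close> apply pointwise; \<open>n\<close> is a strict bound on the formal degree.\<close>

definition fam :: "'m set \<Rightarrow> nat \<Rightarrow> ('k::field ^ 'm::finite \<Rightarrow> 'k poly) set" where
  "fam U n = {F. (\<forall>i. (\<lambda>x. coeff (F x) i) \<in> Pol U) \<and> (\<forall>i\<ge>n. \<forall>x. coeff (F x) i = 0)}"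

lemma fam_coeff: "F \<in> fam U n \<Longrightarrow> (\<lambda>x. coeff (F x) i) \<in> Pol U"
  and fam_zero: "F \<in> fam U n \<Longrightarrow> n \<le> i \<Longrightarrow> coeff (F x) i = 0"
  by (auto simp: fam_def)

lemma fam_mono: "F \<in> fam U n \<Longrightarrow> n \<le> m \<Longrightarrow> F \<in> fam U m"
  by (auto simp: fam_def)

lemma fam_monom:
  assumes "f \<in> Pol U" "n < m"
  shows "(\<lambda>x. monom (f x) n) \<in> fam U m"
proof -
  have "(\<lambda>x. coeff (monom (f x) n) i) \<in> Pol U" for i
    using assms(1) by (cases "n = i") (auto intro: Pol_const)
  then show ?thesis using assms(2) by (auto simp: fam_def)
qed

lemma fam_0: "(\<lambda>x. 0) \<in> fam U n"
  by (auto simp: fam_def intro: Pol_intros)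

lemma fam_add: "F \<in> fam U n \<Longrightarrow> G \<in> fam U n \<Longrightarrow> (\<lambda>x. F x + G x) \<in> fam U n"
  by (auto simp: fam_def intro: Pol_intros)

lemma fam_diff: "F \<in> fam U n \<Longrightarrow> G \<in> fam U n \<Longrightarrow> (\<lambda>x. F x - G x) \<in> fam U n"
  by (auto simp: fam_def intro: Pol_intros)

lemma fam_smult: "f \<in> Pol U \<Longrightarrow> F \<in> fam U n \<Longrightarrow> (\<lambda>x. smult (f x) (F x)) \<in> fam U n"
  by (auto simp: fam_def intro: Pol_intros)

lemma fam_mult_coeff: "F \<in> fam U n \<Longrightarrow> G \<in> fam U m \<Longrightarrow> (\<lambda>x. coeff (F x * G x) i) \<in> Pol U"
  unfolding coeff_mult by (intro Pol_intros) (auto simp: fam_def)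

text \<open>Since \<open>n\<close> and \<open>Suc m\<close> are strict bounds, the degrees are at
  most n - 1 and m, which makes n + m a strict bound for the product; for n = 0 the first factor is
  0.\<close>

lemma fam_mult: "F \<in> fam U n \<Longrightarrow> G \<in> fam U (Suc m) \<Longrightarrow> (\<lambda>x. F x * G x) \<in> fam U (n + m)"
  unfolding fam_def mem_Collect_eq
proof (intro conjI allI impI, goal_cases)
  case (1 i)
  then show ?case using fam_mult_coeff[of F U n G "Suc m" i] by (simp add: fam_def)
next
  case (2 i x)
  have "coeff (F x) j * coeff (G x) (i - j) = 0" if "j \<le> i" for j
    using 2 that by (cases "n \<le> j") auto
  then show ?case unfolding coeff_mult by (intro sum.neutral) auto
qed

lemma poly_eq_sum_lessThan:
  fixes p :: "'a::comm_semiring_1 poly"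
  assumes "\<And>i. n \<le> i \<Longrightarrow> coeff p i = 0"
  shows "poly p x = (\<Sum>i<n. coeff p i * x ^ i)"
proof -
  have "(\<Sum>i\<le>degree p. coeff p i * x ^ i) = (\<Sum>i<n + Suc (degree p). coeff p i * x ^ i)"
    by (rule sum.mono_neutral_left) (auto simp: coeff_eq_0)
  also have "\<dots> = (\<Sum>i<n. coeff p i * x ^ i)"
    by (rule sum.mono_neutral_right) (auto simp: assms)
  finally show ?thesis by (simp add: poly_altdef)
qed

lemma fam_eval:
  assumes F: "F \<in> fam U n" and f: "f \<in> Pol W" and "U \<subseteq> W"
  shows "(\<lambda>x. poly (F x) (f x)) \<in> Pol W"
proof -
  have "(\<lambda>x. poly (F x) (f x)) = (\<lambda>x. \<Sum>i<n. coeff (F x) i * f x ^ i)"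
    by (intro ext poly_eq_sum_lessThan fam_zero[OF F])
  then show ?thesis
    using assms by (auto intro!: Pol_intros intro: fam_coeff Pol_mono)
qed

lemma fam_cong: "F \<in> fam U n \<Longrightarrow> (\<And>i. i \<in> U \<Longrightarrow> x $ i = y $ i) \<Longrightarrow> F x = F y"
  by (intro poly_eqI Pol_cong[OF fam_coeff]) auto

lemma Pol_insert_fam:
  "f \<in> Pol (insert j U) \<Longrightarrow> \<exists>n. \<exists>F\<in>fam U n. f = (\<lambda>x. poly (F x) (x $ j))"
proof (induction rule: Pol.induct)
  case (Pol_const c)
  show ?case
    by (intro exI[of _ 1] bexI[of _ "\<lambda>x. monom c 0"] fam_monom) (auto simp: monom_0 intro: Pol_intros)
next
  case (Pol_var i)
  show ?case
  proof (cases "i = j")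
    case True
    then show ?thesis
      by (intro exI[of _ 2] bexI[of _ "\<lambda>x. monom 1 1"] fam_monom) (auto simp: poly_monom intro: Pol_intros)
  next
    case False
    with Pol_var show ?thesis
      by (intro exI[of _ 1] bexI[of _ "\<lambda>x. monom (x $ i) 0"] fam_monom) (auto simp: monom_0 intro: Pol_intros)
  qed
next
  case (Pol_add f g)
  then obtain n F m G where *: "F \<in> fam U n" "f = (\<lambda>x. poly (F x) (x $ j))"
      "G \<in> fam U m" "g = (\<lambda>x. poly (G x) (x $ j))" by blast
  then have "(\<lambda>x. F x + G x) \<in> fam U (max n m)"
    using fam_add fam_mono[of F U n "max n m"] fam_mono[of G U m "max n m"] by simp
  then show ?case
    by (intro exI[of _ "max n m"] bexI[of _ "\<lambda>x. F x + G x"]) (auto simp: *)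
next
  case (Pol_mult f g)
  then obtain n F m G where *: "F \<in> fam U n" "f = (\<lambda>x. poly (F x) (x $ j))"
      "G \<in> fam U m" "g = (\<lambda>x. poly (G x) (x $ j))" by blast
  then have "(\<lambda>x. F x * G x) \<in> fam U (n + m)"
    using fam_mult fam_mono[of G U m "Suc m"] by simp
  then show ?case
    by (intro exI[of _ "n + m"] bexI[of _ "\<lambda>x. F x * G x"]) (auto simp: *)
qed

text \<open>The coefficients are functions that may vanish somewhere, so division by the leading one
  is impossible; multiplying by it before each cancellation replaces division. One exponent k serves
  all points, and coefficient d counts as leading even where it vanishes.\<close>

lemma fam_pseudo_division:
  assumes G: "G \<in> fam U (Suc d)"
  shows "F \<in> fam U n \<Longrightarrow> \<exists>k. \<exists>S\<in>fam U (n - d). \<exists>R\<in>fam U d.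
           \<forall>x. smult (coeff (G x) d ^ k) (F x) = G x * S x + R x"
proof (induction n arbitrary: F)
  case 0
  then show ?case
    by (intro exI[of _ 0] bexI[of _ "\<lambda>x. 0"] bexI[of _ F])
      (auto intro: fam_0 fam_mono[of _ _ 0])
next
  case (Suc m)
  show ?case
  proof (cases "Suc m \<le> d")
    case True
    then show ?thesis using Suc.prems
      by (intro exI[of _ 0] bexI[of _ "\<lambda>x. 0"] bexI[of _ F])
        (auto intro: fam_0 fam_mono[of _ _ "Suc m"])
  next
    case False
    define g where "g x = coeff (G x) d" for x
    define M where "M x = monom (coeff (F x) m) (m - d)" for x
    define F' where "F' x = smult (g x) (F x) - G x * M x" for x
    have g: "g \<in> Pol U" unfolding g_def using G by (rule fam_coeff)
    have M: "M \<in> fam U (Suc (m - d))"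
      unfolding M_def by (intro fam_monom fam_coeff[OF Suc.prems]) auto
    have "F' \<in> fam U (Suc m)"
      using fam_diff[OF fam_smult[OF g Suc.prems] fam_mono[OF fam_mult[OF G M], of "Suc m"]] False
      unfolding F'_def by simp
    moreover have "coeff (F' x) m = 0" for x
    proof -
      have "coeff (G x * M x) m = coeff (M x * G x) m" by (simp add: mult.commute)
      also have "\<dots> = coeff (F x) m * g x"
        using False by (simp add: M_def g_def coeff_monom_mult)
      finally show ?thesis by (simp add: F'_def)
    qed
    ultimately have "F' \<in> fam U m"
      unfolding fam_def by auto (metis Suc_leI le_neq_implies_less)
    from Suc.IH[OF this] obtain k S R where
      *: "S \<in> fam U (m - d)" "R \<in> fam U d"
      "\<And>x. smult (g x ^ k) (F' x) = G x * S x + R x" unfolding g_def by blast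
    define S' where "S' x = S x + smult (g x ^ k) (M x)" for x
    have "S' \<in> fam U (Suc m - d)"
      unfolding S'_def using M False
      by (intro fam_add fam_smult Pol_power g fam_mono[OF *(1)]) (auto simp: Suc_diff_le)
    moreover have "smult (g x ^ Suc k) (F x) = G x * S' x + R x" for x
    proof -
      have "smult (g x ^ Suc k) (F x) = smult (g x ^ k) (F' x) + smult (g x ^ k) (G x * M x)"
        by (simp add: F'_def smult_diff_right mult.commute)
      then show ?thesis by (simp add: *(3) S'_def algebra_simps)
    qed
    ultimately show ?thesis using *(2) unfolding g_def by blast
  qed
qed

section \<open>The Hilbert basis theorem and the Zariski topology\<close>

definition pol_ideal :: "'m set \<Rightarrow> ('k::field ^ 'm::finite \<Rightarrow> 'k) set \<Rightarrow> bool" where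
  "pol_ideal U J \<longleftrightarrow> J \<subseteq> Pol U \<and> (\<lambda>_. 0) \<in> J \<and> (\<forall>f\<in>J. \<forall>g\<in>J. (\<lambda>x. f x + g x) \<in> J)
     \<and> (\<forall>f\<in>Pol U. \<forall>g\<in>J. (\<lambda>x. f x * g x) \<in> J)"

lemma pol_ideal_subset: "pol_ideal U J \<Longrightarrow> f \<in> J \<Longrightarrow> f \<in> Pol U"
  and pol_ideal_0: "pol_ideal U J \<Longrightarrow> (\<lambda>_. 0) \<in> J"
  and pol_ideal_add: "pol_ideal U J \<Longrightarrow> f \<in> J \<Longrightarrow> g \<in> J \<Longrightarrow> (\<lambda>x. f x + g x) \<in> J"
  and pol_ideal_mult: "pol_ideal U J \<Longrightarrow> h \<in> Pol U \<Longrightarrow> g \<in> J \<Longrightarrow> (\<lambda>x. h x * g x) \<in> J"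
  unfolding pol_ideal_def by blast+

lemma pol_ideal_diff: "pol_ideal U J \<Longrightarrow> f \<in> J \<Longrightarrow> g \<in> J \<Longrightarrow> (\<lambda>x. f x - g x) \<in> J"
  using pol_ideal_add[of U J f "\<lambda>x. -1 * g x"] pol_ideal_mult[OF _ Pol_const[of "-1"], of U J g]
  by simp

text \<open>The leading coefficient ideals of the classical proof of Hilbert's basis theorem. The
  degree bound is formal, so coefficient k may be zero; this makes the set closed under
  addition.\<close>

definition leading :: "'m \<Rightarrow> 'm set \<Rightarrow> nat \<Rightarrow> ('k::field ^ 'm::finite \<Rightarrow> 'k) set \<Rightarrow> ('k ^ 'm \<Rightarrow> 'k) set" where
  "leading j U k J = {\<lambda>x. coeff (F x) k | F. F \<in> fam U (Suc k) \<and> (\<lambda>x. poly (F x) (x $ j)) \<in> J}"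

lemma leadingI:
  "F \<in> fam U (Suc k) \<Longrightarrow> (\<lambda>x. poly (F x) (x $ j)) \<in> J \<Longrightarrow> r = (\<lambda>x. coeff (F x) k) \<Longrightarrow> r \<in> leading j U k J"
  unfolding leading_def by blast

lemma leadingE:
  assumes "r \<in> leading j U k J"
  obtains F where "F \<in> fam U (Suc k)" "(\<lambda>x. poly (F x) (x $ j)) \<in> J" "r = (\<lambda>x. coeff (F x) k)"
  using assms unfolding leading_def by blast

lemma leading_ideal:
  fixes J :: "('k::field ^ 'm::finite \<Rightarrow> 'k) set"
  assumes J: "pol_ideal (insert j U) J"
  shows "pol_ideal U (leading j U k J)"
  unfolding pol_ideal_def
proof (intro conjI ballI subsetI)
  fix r assume "r \<in> leading j U k J"
  then show "r \<in> Pol U" by (elim leadingE) (auto intro: fam_coeff)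
next
  show "(\<lambda>_. 0) \<in> leading j U k J"
    by (rule leadingI[of "\<lambda>_. 0"]) (use pol_ideal_0[OF J] fam_0 in auto)
next
  fix r s assume "r \<in> leading j U k J" "s \<in> leading j U k J"
  then obtain F G where F: "F \<in> fam U (Suc k)" "(\<lambda>x. poly (F x) (x $ j)) \<in> J" "r = (\<lambda>x. coeff (F x) k)"
    and G: "G \<in> fam U (Suc k)" "(\<lambda>x. poly (G x) (x $ j)) \<in> J" "s = (\<lambda>x. coeff (G x) k)"
    by (elim leadingE)
  show "(\<lambda>x. r x + s x) \<in> leading j U k J"
    by (rule leadingI[OF fam_add[OF F(1) G(1)]]) (use pol_ideal_add[OF J F(2) G(2)] F G in auto)
next
  fix h r :: "'k ^ 'm \<Rightarrow> 'k" assume h: "h \<in> Pol U" and "r \<in> leading j U k J"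
  then obtain F where F: "F \<in> fam U (Suc k)" "(\<lambda>x. poly (F x) (x $ j)) \<in> J" "r = (\<lambda>x. coeff (F x) k)"
    by (elim leadingE)
  have "h \<in> Pol (insert j U)" using h by (rule Pol_mono) auto
  then show "(\<lambda>x. h x * r x) \<in> leading j U k J"
    by (intro leadingI[OF fam_smult[OF h F(1)]]) (use pol_ideal_mult[OF J _ F(2)] F in auto)
qed

lemma leading_mono: "I \<subseteq> J \<Longrightarrow> leading j U k I \<subseteq> leading j U k J"
  unfolding leading_def by blast

lemma leading_Suc:
  assumes J: "pol_ideal (insert j U) J"
  shows "leading j U k J \<subseteq> leading j U (Suc k) J"
proof
  fix r assume "r \<in> leading j U k J"
  then obtain F where F: "F \<in> fam U (Suc k)" "(\<lambda>x. poly (F x) (x $ j)) \<in> J" "r = (\<lambda>x. coeff (F x) k)"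
    by (elim leadingE)
  have "(\<lambda>x. F x * monom 1 1) \<in> fam U (Suc (Suc k))"
    using fam_mult[OF F(1) fam_monom[OF Pol_const, of 1 "Suc 1" 1]] by simp
  then show "r \<in> leading j U (Suc k) J"
  proof (rule leadingI)
    show "(\<lambda>x. poly (F x * monom 1 1) (x $ j)) \<in> J"
      using pol_ideal_mult[OF J Pol_var F(2), of j] by (simp add: poly_monom mult.commute)
    show "r = (\<lambda>x. coeff (F x * monom 1 1) (Suc k))"
      by (simp add: F(3) coeff_monom_mult mult.commute[of _ "monom 1 (Suc 0)"])
  qed
qed

lemma leading_le:
  "pol_ideal (insert j U) J \<Longrightarrow> k \<le> l \<Longrightarrow> leading j U k J \<subseteq> leading j U l J"
  by (rule lift_Suc_mono_le[of "\<lambda>k. leading j U k J"]) (auto dest: leading_Suc)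

text \<open>Each element of J agrees in its top coefficient with some element of I; the difference
  lies in J and has a smaller formal degree, so the descent ends at 0.\<close>

lemma pol_ideal_eqI_leading:
  assumes I: "pol_ideal (insert j U) I" and J: "pol_ideal (insert j U) J" and "I \<subseteq> J"
    and eq: "\<And>k. leading j U k J \<subseteq> leading j U k I"
  shows "I = J"
proof -
  have "(\<lambda>x. poly (F x) (x $ j)) \<in> J \<Longrightarrow> (\<lambda>x. poly (F x) (x $ j)) \<in> I" if "F \<in> fam U n" for F n
    using that
  proof (induction n arbitrary: F)
    case 0
    then have "F = (\<lambda>x. 0)" by (intro ext poly_eqI) (auto simp: fam_def)
    then show ?case using pol_ideal_0[OF I] by simp
  next
    case (Suc k)
    then have "(\<lambda>x. coeff (F x) k) \<in> leading j U k J" by (intro leadingI[OF Suc.prems(2,1)]) auto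
    then have "(\<lambda>x. coeff (F x) k) \<in> leading j U k I" using eq by blast
    then obtain G where G: "G \<in> fam U (Suc k)" "(\<lambda>x. poly (G x) (x $ j)) \<in> I"
      "(\<lambda>x. coeff (F x) k) = (\<lambda>x. coeff (G x) k)" by (elim leadingE)
    have "(\<lambda>x. F x - G x) \<in> fam U k"
      using fam_diff[OF Suc.prems(2) G(1)] fun_cong[OF G(3)] unfolding fam_def
      by auto (metis Suc_leI le_neq_implies_less)
    moreover have "(\<lambda>x. poly (F x - G x) (x $ j)) \<in> J"
      using pol_ideal_diff[OF J Suc.prems(1)] G(2) \<open>I \<subseteq> J\<close> by auto
    ultimately have "(\<lambda>x. poly (F x - G x) (x $ j)) \<in> I" by (intro Suc.IH)
    from pol_ideal_add[OF I this G(2)] show ?case by simp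
  qed
  then have "J \<subseteq> I" using Pol_insert_fam pol_ideal_subset[OF J] by blast
  with \<open>I \<subseteq> J\<close> show ?thesis by blast
qed

lemma pol_ideal_ACC:
  fixes J :: "nat \<Rightarrow> ('k::field ^ 'm::finite \<Rightarrow> 'k) set"
  assumes "finite U" "\<And>n. pol_ideal U (J n)" "\<And>n. J n \<subseteq> J (Suc n)"
  shows "\<exists>N. \<forall>n\<ge>N. J n = J N"
  using assms
proof (induction U arbitrary: J rule: finite_induct)
  case empty
  have mono: "J n \<subseteq> J m" if "n \<le> m" for n m using lift_Suc_mono_le[of J] empty that by blast
  show ?case
  proof (cases "\<exists>n. \<exists>f\<in>J n. f \<noteq> (\<lambda>_. 0)")
    case True
    then obtain n f where f: "f \<in> J n" "f \<noteq> (\<lambda>_. 0)" by blast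
    obtain c where c: "f = (\<lambda>_. c)" using Pol_empty pol_ideal_subset[OF empty(1) f(1)] by blast
    have "Pol {} \<subseteq> J n"
    proof
      fix g :: "'k ^ 'm \<Rightarrow> 'k" assume "g \<in> Pol {}"
      then have "(\<lambda>x. (g x * (1 / c)) * f x) \<in> J n"
        by (intro pol_ideal_mult[OF empty(1) _ f(1)] Pol_intros)
      moreover have "c \<noteq> 0" using f c by auto
      ultimately show "g \<in> J n" by (simp add: c)
    qed
    then have "J m = Pol {}" if "m \<ge> n" for m
      using mono[OF that] pol_ideal_subset[OF empty(1), of _ m] by blast
    then show ?thesis by (metis order_refl)
  next
    case False
    then have "J n = {\<lambda>_. 0}" for n using pol_ideal_0[OF empty(1), of n] by blast
    then show ?thesis by simp
  qed
next
  case (insert j U)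
  have mono: "J n \<subseteq> J m" if "n \<le> m" for n m using lift_Suc_mono_le[of J] insert that by blast
  let ?L = "leading j U"
  have L_mono: "?L k (J n) \<subseteq> ?L l (J m)" if "k \<le> l" "n \<le> m" for k l n m
    using leading_le[OF insert.prems(1) that(1), of n] leading_mono[OF mono[OF that(2)]] by blast
  \<comment> \<open>Leading ideals grow both with the degree and along the chain. The diagonal
    settles all large degrees; the finitely many degrees up to N0 are settled one by one, and N is
    the maximum of all these thresholds.\<close>
  have "\<exists>N. \<forall>n\<ge>N. ?L n (J n) = ?L N (J N)"
    by (rule insert.IH) (intro leading_ideal insert.prems(1) L_mono; simp)+
  then obtain N0 where N0: "\<And>n. n \<ge> N0 \<Longrightarrow> ?L n (J n) = ?L N0 (J N0)" by blast
  have "\<exists>N. \<forall>n\<ge>N. ?L k (J n) = ?L k (J N)" for k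
    by (rule insert.IH) (intro leading_ideal insert.prems(1) L_mono; simp)+
  then obtain M where M: "\<And>k n. n \<ge> M k \<Longrightarrow> ?L k (J n) = ?L k (J (M k))" by metis
  define N where "N = Max (insert N0 (M ` {..N0}))"
  have N: "N0 \<le> N" "M k \<le> N" if "k \<le> N0" for k
    unfolding N_def using that by (intro Max_ge; simp)+
  have "?L k (J n) \<subseteq> ?L k (J N)" if "n \<ge> N" for k n
  proof (cases "k \<le> N0")
    case True
    then show ?thesis using M[of k n] M[of k N] N(2)[of k] that by simp
  next
    case False
    \<comment> \<open>Both ideals are compared with the stable diagonal one, which already lies in
      \<open>?L k (J N)\<close> because k exceeds N0.\<close>
    have "?L k (J n) \<subseteq> ?L (max k n) (J (max k n))" by (rule L_mono) auto
    also have "\<dots> = ?L N0 (J N0)" using N0[of "max k n"] False by simp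
    also have "\<dots> \<subseteq> ?L k (J N)" using L_mono[of N0 k N0 N] False N(1)[of 0] by simp
    finally show ?thesis .
  qed
  then have "J N = J n" if "n \<ge> N" for n
    using that by (intro pol_ideal_eqI_leading[OF insert.prems(1) insert.prems(1)] mono) auto
  then show ?case by metis
qed

section \<open>Formal polynomials and polynomial functions\<close>

lemma mpoly_eval_superset:
  assumes "finite E" "Poly_Mapping.keys p \<subseteq> E"
  shows "mpoly_eval p x = (\<Sum>e\<in>E. Poly_Mapping.lookup p e * (\<Prod>i\<in>UNIV. (x $ i) ^ Poly_Mapping.lookup e i))"
  unfolding mpoly_eval_def using assms
  by (intro sum.mono_neutral_left) (auto simp: in_keys_iff)

lemma mpoly_eval_add: "mpoly_eval (p + q) x = mpoly_eval p x + mpoly_eval q x"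
  using Poly_Mapping.keys_add[of p q]
  by (simp add: mpoly_eval_superset[of "Poly_Mapping.keys p \<union> Poly_Mapping.keys q"] lookup_add
      distrib_right sum.distrib)

lemma mpoly_eval_single:
  "mpoly_eval (Poly_Mapping.single e c) x = c * (\<Prod>i\<in>UNIV. (x $ i) ^ Poly_Mapping.lookup e i)"
  by (simp add: mpoly_eval_superset[of "{e}"])

lemma mpoly_eval_sum: "mpoly_eval (\<Sum>a\<in>A. f a) x = (\<Sum>a\<in>A. mpoly_eval (f a) x)"
  by (induction A rule: infinite_finite_induct) (auto simp: mpoly_eval_add, auto simp: mpoly_eval_def)

lemma mpoly_eval_mult: "\<exists>r. mpoly_eval r = (\<lambda>x. mpoly_eval p x * mpoly_eval q x)"
proof
  show "mpoly_eval (\<Sum>e\<in>Poly_Mapping.keys p. \<Sum>f\<in>Poly_Mapping.keys q. 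
      Poly_Mapping.single (e + f) (Poly_Mapping.lookup p e * Poly_Mapping.lookup q f))
    = (\<lambda>x. mpoly_eval p x * mpoly_eval q x)"
    unfolding mpoly_eval_sum[abs_def] mpoly_eval_single
    by (simp add: fun_eq_iff mpoly_eval_sum mpoly_eval_single mpoly_eval_def[of p] mpoly_eval_def[of q]
        sum_product lookup_add power_add prod.distrib mult_ac)
qed

lemma Pol_UNIV_eq: "Pol UNIV = range mpoly_eval"
proof (intro equalityI subsetI)
  fix f :: "'a ^ 'b \<Rightarrow> 'a" assume "f \<in> Pol UNIV"
  then show "f \<in> range mpoly_eval"
  proof (induction rule: Pol.induct)
    case (Pol_const c)
    have "mpoly_eval (Poly_Mapping.single 0 c) = (\<lambda>_ :: 'a ^ 'b. c)" by (simp add: fun_eq_iff mpoly_eval_single)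
    then show ?case by (metis rangeI)
  next
    case (Pol_var i)
    have "mpoly_eval (Poly_Mapping.single (Poly_Mapping.single i 1) 1) x = x $ i" for x :: "'a ^ 'b"
    proof -
      have "(\<Prod>k\<in>UNIV. (x $ k) ^ Poly_Mapping.lookup (Poly_Mapping.single i (1::nat)) k)
          = (\<Prod>k\<in>UNIV. if i = k then x $ k else 1)"
        by (intro prod.cong) (auto simp: lookup_single when_def)
      then show ?thesis by (simp add: mpoly_eval_single)
    qed
    then have "mpoly_eval (Poly_Mapping.single (Poly_Mapping.single i 1) 1) = (\<lambda>x :: 'a ^ 'b. x $ i)" by blast
    then show ?case by (metis rangeI)
  next
    case (Pol_add f g)
    then obtain p q where "f = mpoly_eval p" "g = mpoly_eval q" by blast
    then have "(\<lambda>x. f x + g x) = mpoly_eval (p + q)" by (simp add: fun_eq_iff mpoly_eval_add)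
    then show ?case by blast
  next
    case (Pol_mult f g)
    then obtain p q where "f = mpoly_eval p" "g = mpoly_eval q" by blast
    then show ?case using mpoly_eval_mult[of p q] by (metis rangeI)
  qed
next
  fix f :: "'a ^ 'b \<Rightarrow> 'a" assume "f \<in> range mpoly_eval"
  then show "f \<in> Pol UNIV" by (auto simp: mpoly_eval_def[abs_def] intro!: Pol_intros)
qed

section \<open>Closed sets and the descending chain condition\<close>

lemma zariski_closed_iff_Pol:
  fixes X :: "('k::field ^ 'm::finite) set"
  shows "zariski_closed X \<longleftrightarrow> (\<exists>P\<subseteq>Pol UNIV. X = {x. \<forall>p\<in>P. p x = 0})"
proof
  assume "zariski_closed X"
  then obtain P where "X = zero_locus P" unfolding zariski_closed_def by blast
  then show "\<exists>P\<subseteq>Pol UNIV. X = {x. \<forall>p\<in>P. p x = 0}"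
    by (intro exI[of _ "mpoly_eval ` P"]) (auto simp: Pol_UNIV_eq zero_locus_def)
next
  assume "\<exists>P\<subseteq>Pol UNIV. X = {x. \<forall>p\<in>P. p x = 0}"
  then obtain P where P: "P \<subseteq> Pol UNIV" "X = {x. \<forall>p\<in>P. p x = 0}" by blast
  then have "X = zero_locus {p. mpoly_eval p \<in> P}"
    unfolding zero_locus_def Pol_UNIV_eq by blast
  then show "zariski_closed X" unfolding zariski_closed_def by blast
qed

lemma zariski_closed_zeros: "P \<subseteq> Pol UNIV \<Longrightarrow> zariski_closed {x. \<forall>p\<in>P. p x = 0}"
  unfolding zariski_closed_iff_Pol by blast

lemma zariski_closed_Int:
  fixes X Y :: "('k::field ^ 'm::finite) set"
  shows "zariski_closed X \<Longrightarrow> zariski_closed Y \<Longrightarrow> zariski_closed (X \<inter> Y)"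
proof -
  assume "zariski_closed X" "zariski_closed Y"
  then obtain P Q where "P \<subseteq> Pol UNIV" "X = {x. \<forall>p\<in>P. p x = 0}"
    "Q \<subseteq> Pol UNIV" "Y = {x. \<forall>p\<in>Q. p x = 0}" unfolding zariski_closed_iff_Pol by blast
  then show ?thesis unfolding zariski_closed_iff_Pol by (intro exI[of _ "P \<union> Q"]) auto
qed

lemma zariski_closed_zero: "f \<in> Pol UNIV \<Longrightarrow> zariski_closed {x. f x = 0}"
  using zariski_closed_zeros[of "{f}"] by simp

lemma zariski_closed_separate:
  fixes X :: "('k::field ^ 'm::finite) set"
  assumes "zariski_closed X" "x \<notin> X"
  shows "\<exists>f\<in>Pol UNIV. (\<forall>y\<in>X. f y = 0) \<and> f x \<noteq> 0"
  using assms unfolding zariski_closed_iff_Pol by blast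

text \<open>The vanishing ideals of a strictly descending chain of closed sets ascend, hence become
  stationary by Hilbert's basis theorem; but a point lost in a step is separated from the smaller
  set by a polynomial, so the ideals keep growing.\<close>

lemma wf_zariski_closed:
  "wf {(X, Y). zariski_closed X \<and> zariski_closed Y \<and> X \<subset> (Y :: ('k::field ^ 'm::finite) set)}"
  unfolding wf_iff_no_infinite_down_chain
proof
  assume "\<exists>X. \<forall>i. (X (Suc i), X i) \<in> {(X, Y). zariski_closed X \<and> zariski_closed Y \<and> X \<subset> (Y :: ('k ^ 'm) set)}"
  then obtain X :: "nat \<Rightarrow> ('k ^ 'm) set"
    where "\<forall>i. zariski_closed (X (Suc i)) \<and> zariski_closed (X i) \<and> X (Suc i) \<subset> X i" by auto
  then have X: "\<And>i. zariski_closed (X i)" "\<And>i. X (Suc i) \<subset> X i" by simp_all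
  define J where "J n = {f \<in> Pol UNIV. \<forall>x\<in>X n. f x = 0}" for n
  have "\<exists>N. \<forall>n\<ge>N. J n = J N"
  proof (rule pol_ideal_ACC[of UNIV])
    show "pol_ideal UNIV (J n)" for n
      by (auto simp: pol_ideal_def J_def intro: Pol_intros)
    show "J n \<subseteq> J (Suc n)" for n using X(2)[of n] unfolding J_def by blast
  qed auto
  then obtain N where N: "J (Suc N) = J N" by (metis le_SucI order_refl)
  obtain x where x: "x \<in> X N" "x \<notin> X (Suc N)" using X(2) by blast
  with zariski_closed_separate[OF X(1) x(2)] N show False unfolding J_def by blast
qed

lemma zariski_closed_minimal:
  fixes X :: "('k::field ^ 'm::finite) set"
  assumes "zariski_closed X" "Q X"
  obtains Y where "zariski_closed Y" "Q Y" "Y \<subseteq> X" "\<And>Z. zariski_closed Z \<Longrightarrow> Q Z \<Longrightarrow> Z \<subseteq> Y \<Longrightarrow> Z = Y"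
proof -
  let ?r = "{(X, Y). zariski_closed X \<and> zariski_closed Y \<and> X \<subset> (Y :: ('k ^ 'm) set)}"
  from assms have "X \<in> {Y. zariski_closed Y \<and> Q Y \<and> Y \<subseteq> X}" by simp
  then show ?thesis
  proof (rule wfE_min[OF wf_zariski_closed])
    fix Y assume Y: "Y \<in> {Y. zariski_closed Y \<and> Q Y \<and> Y \<subseteq> X}"
      and min: "\<And>Z. (Z, Y) \<in> ?r \<Longrightarrow> Z \<notin> {Y. zariski_closed Y \<and> Q Y \<and> Y \<subseteq> X}"
    show ?thesis
    proof (rule that)
      show "zariski_closed Y" "Q Y" "Y \<subseteq> X" using Y by auto
      fix Z assume Z: "zariski_closed Z" "Q Z" "Z \<subseteq> Y"
      show "Z = Y"
      proof (rule ccontr)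
        assume "Z \<noteq> Y"
        then have "(Z, Y) \<in> ?r" using Y Z by auto
        from min[OF this] show False using Y Z by auto
      qed
    qed
  qed
qed

text \<open>Among the closed sets cut out by finitely many members of a defining family there is a
  minimal one, and no further member can shrink it. Finiteness matters later, when one exponent has
  to serve all defining polynomials.\<close>

lemma zariski_closed_finite_zeros:
  fixes X :: "('k::field ^ 'm::finite) set"
  assumes "zariski_closed X"
  obtains P where "finite P" "P \<subseteq> Pol UNIV" "X = {x. \<forall>p\<in>P. p x = 0}"
proof -
  obtain P where P: "P \<subseteq> Pol UNIV" "X = {x. \<forall>p\<in>P. p x = 0}"
    using assms unfolding zariski_closed_iff_Pol by blast
  define Q where "Q Y \<longleftrightarrow> (\<exists>F\<subseteq>P. finite F \<and> Y = {x. \<forall>p\<in>F. p x = 0})" for Y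
  have "zariski_closed (UNIV :: ('k ^ 'm) set)" using zariski_closed_zeros[of "{}"] by simp
  moreover have "Q UNIV" unfolding Q_def by auto
  ultimately obtain Y where Y: "zariski_closed Y" "Q Y"
    "\<And>Z. zariski_closed Z \<Longrightarrow> Q Z \<Longrightarrow> Z \<subseteq> Y \<Longrightarrow> Z = Y"
    by (rule zariski_closed_minimal) blast
  then obtain F where F: "F \<subseteq> P" "finite F" "Y = {x. \<forall>p\<in>F. p x = 0}" unfolding Q_def by blast
  have "p x = 0" if "p \<in> P" "x \<in> Y" for p x
  proof -
    have "zariski_closed {x. \<forall>p\<in>insert p F. p x = 0}" using that F P by (intro zariski_closed_zeros) auto
    moreover have "Q {x. \<forall>p\<in>insert p F. p x = 0}"
      unfolding Q_def using that F by (intro exI[of _ "insert p F"]) auto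
    ultimately have "{x. \<forall>p\<in>insert p F. p x = 0} = Y" using F(3) by (intro Y(3)) auto
    then show ?thesis using that by blast
  qed
  then have "X = Y" using P F by blast
  then show ?thesis using that[of F] F P by auto
qed

section \<open>Generic extension of points\<close>

text \<open>Irreducibility enters the algebra as primeness of the vanishing ideal: in a product that
  vanishes on \<open>V\<close>, a factor that does not vanish identically can be cancelled.\<close>

locale prime_locus =
  fixes V :: "('k::{alg_closed_field, field_char_0} ^ 'm::finite) set"
  assumes prime: "f \<in> Pol UNIV \<Longrightarrow> g \<in> Pol UNIV \<Longrightarrow> \<forall>x\<in>V. f x * g x = 0 \<Longrightarrow>
    (\<forall>x\<in>V. f x = 0) \<or> (\<forall>x\<in>V. g x = 0)"
begin

definition van :: "('k ^ 'm \<Rightarrow> 'k) \<Rightarrow> bool" where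
  "van f \<longleftrightarrow> (\<forall>x\<in>V. f x = 0)"

text \<open>The Zariski closure of the projection of \<open>V\<close> to the coordinates in \<open>U\<close>, as a cylinder in the
  full space.\<close>

definition proj_closure :: "'m set \<Rightarrow> ('k ^ 'm) set" where
  "proj_closure U = {y. \<forall>f\<in>Pol U. van f \<longrightarrow> f y = 0}"

lemma van_mult:
  "f \<in> Pol U \<Longrightarrow> g \<in> Pol W \<Longrightarrow> van (\<lambda>x. f x * g x) \<Longrightarrow> van f \<or> van g"
  unfolding van_def using prime[of f g] Pol_mono[of _ _ UNIV] by blast

lemma van_power_mult:
  assumes f: "f \<in> Pol U" and g: "g \<in> Pol W" and "van (\<lambda>x. f x ^ n * g x)" and "\<not> van f"
  shows "van g"
  using assms(3)
proof (induction n)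
  case (Suc n)
  have "(\<lambda>x. f x ^ n * g x) \<in> Pol UNIV"
    by (intro Pol_intros Pol_mono[OF f] Pol_mono[OF g]) auto
  then show ?case using van_mult[OF f, of "\<lambda>x. f x ^ n * g x" UNIV] Suc assms(4) by (simp add: mult.assoc)
qed simp

lemma van_coeffs: "(\<And>i. van (\<lambda>x. coeff (F x) i)) \<Longrightarrow> x \<in> V \<Longrightarrow> F x = 0"
  unfolding van_def by (intro poly_eqI) auto

lemma proj_closure_coeffs:
  "F \<in> fam U n \<Longrightarrow> (\<And>i. van (\<lambda>x. coeff (F x) i)) \<Longrightarrow> y \<in> proj_closure U \<Longrightarrow> F y = 0"
  unfolding proj_closure_def by (intro poly_eqI) (auto dest: fam_coeff)

lemma V_subset_proj_closure: "V \<subseteq> proj_closure U"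
  by (auto simp: proj_closure_def van_def)

lemma fam_truncate:
  assumes F: "F \<in> fam U (Suc n)"
  shows "(\<lambda>x. F x - monom (coeff (F x) n) n) \<in> fam U n"
proof -
  have "(\<lambda>x. F x - monom (coeff (F x) n) n) \<in> fam U (Suc n)"
    by (intro fam_diff F fam_monom fam_coeff[OF F]) auto
  then show ?thesis unfolding fam_def using Suc_leI le_neq_implies_less by fastforce
qed

text \<open>One step of Chevalley's theorem.\<close>

lemma extension_step:
  assumes j: "j \<notin> U" and h: "h \<in> Pol (insert j U)" and nv: "\<not> van h"
  shows "\<exists>h'\<in>Pol U. \<not> van h' \<and> (\<forall>y\<in>proj_closure U. h' y \<noteq> 0 \<longrightarrow>
           (\<exists>y'\<in>proj_closure (insert j U). (\<forall>i\<in>U. y' $ i = y $ i) \<and> h y' \<noteq> 0))"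
proof -
  define ev where "ev G = (\<lambda>x. poly (G x) (x $ j))" for G :: "'k ^ 'm \<Rightarrow> 'k poly"
  \<comment> \<open>\<open>nz G\<close> means nonzero as a polynomial over the functions on V,
    whereas \<open>ev G\<close> substitutes the coordinate x_j. A relation for x_j is a
    \<open>G\<close> with \<open>nz G\<close> and \<open>van (ev G)\<close>.\<close>
  define nz where "nz G \<longleftrightarrow> (\<exists>i. \<not> van (\<lambda>x. coeff (G x) i))" for G :: "'k ^ 'm \<Rightarrow> 'k poly"
  define up :: "'k ^ 'm \<Rightarrow> 'k \<Rightarrow> 'k ^ 'm" where "up y \<xi> = (\<chi> i. if i = j then \<xi> else y $ i)" for y \<xi>
  have up: "up y \<xi> $ j = \<xi>" "\<And>i. i \<in> U \<Longrightarrow> up y \<xi> $ i = y $ i" for y \<xi>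
    using j by (auto simp: up_def)
  have ev_up: "ev G (up y \<xi>) = poly (G y) \<xi>" if "G \<in> fam U n" for G n y \<xi>
    using fam_cong[OF that, of "up y \<xi>" y] by (simp add: ev_def up)
  have ev_Pol: "ev G \<in> Pol UNIV" if "G \<in> fam U n" for G n
    unfolding ev_def by (rule fam_eval[OF that]) (auto intro: Pol_intros)
  have nzD: "G x = 0" if "\<not> nz G" "x \<in> V" for G x
    using that van_coeffs[of G x] by (auto simp: nz_def)
  have nz_closure: "G y = 0" if "G \<in> fam U n" "\<not> nz G" "y \<in> proj_closure U" for G n y
    using that proj_closure_coeffs[of G U n y] by (auto simp: nz_def)
  have in_closure: "up y \<xi> \<in> proj_closure (insert j U)"
    if "\<And>G n. G \<in> fam U n \<Longrightarrow> van (ev G) \<Longrightarrow> poly (G y) \<xi> = 0" for y \<xi>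
    unfolding proj_closure_def
  proof (intro CollectI ballI impI)
    fix f assume f: "f \<in> Pol (insert j U)" "van f"
    from Pol_insert_fam[OF f(1)] obtain G n where G: "G \<in> fam U n" "f = ev G" unfolding ev_def by blast
    then show "f (up y \<xi>) = 0" using that[OF G(1)] ev_up[OF G(1)] f(2) by simp
  qed
  from Pol_insert_fam[OF h] obtain H m where H: "H \<in> fam U m" "h = ev H" unfolding ev_def by blast
  show ?thesis
  proof (cases "\<exists>n. \<exists>G\<in>fam U n. van (ev G) \<and> nz G")
    case False
    \<comment> \<open>Without relations x_j is transcendental over the functions in U, so every
      value is allowed for it above y; only the roots of \<open>H y\<close> have to be
      avoided.\<close>
    have "nz H"
      using nzD[of H] nv H(2) unfolding van_def ev_def by fastforce
    then obtain i where i: "\<not> van (\<lambda>x. coeff (H x) i)" unfolding nz_def by blast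
    show ?thesis
    proof (intro bexI[of _ "\<lambda>x. coeff (H x) i"] conjI i ballI impI)
      show "(\<lambda>x. coeff (H x) i) \<in> Pol U" using H(1) by (rule fam_coeff)
      fix y assume y: "y \<in> proj_closure U" "coeff (H y) i \<noteq> 0"
      then have "finite {\<xi>. poly (H y) \<xi> = 0}" by (intro poly_roots_finite) auto
      then obtain \<xi> where \<xi>: "poly (H y) \<xi> \<noteq> 0"
        using ex_new_if_finite[OF infinite_UNIV_char_0] by blast
      have "up y \<xi> \<in> proj_closure (insert j U)"
        by (rule in_closure) (use False nz_closure y(1) in fastforce)
      then show "\<exists>y'\<in>proj_closure (insert j U). (\<forall>i\<in>U. y' $ i = y $ i) \<and> h y' \<noteq> 0"
        using \<xi> ev_up[OF H(1)] H(2) up(2) by (intro bexI[of _ "up y \<xi>"]) auto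
    qed
  next
    case True
    \<comment> \<open>\<open>F\<close> is a relation of least formal degree D and plays the role of
      a minimal polynomial of x_j; primeness makes it behave as irreducible.\<close>
    define N where "N = (LEAST n. \<exists>G\<in>fam U n. van (ev G) \<and> nz G)"
    from LeastI_ex[OF True] obtain F where F0: "F \<in> fam U N" "van (ev F)" "nz F"
      unfolding N_def by blast
    have minimal: "\<not> nz G" if "G \<in> fam U n" "van (ev G)" "n < N" for G n
      using that not_less_Least[of n "\<lambda>n. \<exists>G\<in>fam U n. van (ev G) \<and> nz G"] unfolding N_def by blast
    have "N \<noteq> 0" using F0 by (auto simp: nz_def fam_def van_def)
    then obtain D where D: "N = Suc D" by (cases N) auto
    note F = F0[unfolded D] and minimal = minimal[unfolded D]
    define a where "a x = coeff (F x) D" for x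
    have a_Pol: "a \<in> Pol U" unfolding a_def by (rule fam_coeff[OF F(1)])
    have a: "\<not> van a"
    proof
      assume *: "van a"
      then have "van (ev (\<lambda>x. F x - monom (coeff (F x) D) D))"
        using F(2) by (simp add: van_def ev_def a_def poly_monom)
      from minimal[OF fam_truncate[OF F(1)] this] have "\<not> nz (\<lambda>x. F x - monom (coeff (F x) D) D)" by simp
      then have "F x = 0" if "x \<in> V" for x using nzD[OF _ that] * that by (fastforce simp: van_def a_def)
      then show False using F(3) by (auto simp: nz_def van_def)
    qed
    have "D \<noteq> 0"
    proof
      assume "D = 0"
      then have "F x = [:a x:]" for x
        using fam_zero[OF F(1)] by (intro poly_eqI) (auto simp: a_def coeff_pCons split: nat.split)
      then show False using F(2) a by (auto simp: ev_def)
    qed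
    \<comment> \<open>Candidates for a gcd of F and H. The multipliers u and v may vary with y in
      any way, since the combination is only ever evaluated above a single y.\<close>
    define J where "J n G \<longleftrightarrow> G \<in> fam U n \<and> nz G \<and> (\<forall>y\<in>proj_closure U. \<exists>u v. G y = u * F y + v * H y)" for n G
    have J_D: "\<exists>n\<le>D. \<exists>G. J n G"
    proof -
      obtain k S R where R: "R \<in> fam U D" "\<And>x. smult (a x ^ k) (H x) = F x * S x + R x"
        using fam_pseudo_division[OF F(1) H(1)] unfolding a_def by blast
      have "nz R"
      proof (rule ccontr)
        assume "\<not> nz R"
        have "van (\<lambda>x. a x ^ k * h x)"
          unfolding van_def
        proof
          fix x assume x: "x \<in> V"
          have "a x ^ k * h x = poly (smult (a x ^ k) (H x)) (x $ j)" by (simp add: H(2) ev_def)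
          also have "\<dots> = 0" using F(2) x nzD[OF \<open>\<not> nz R\<close> x] by (simp add: R(2) van_def ev_def)
          finally show "a x ^ k * h x = 0" .
        qed
        then show False using van_power_mult[OF a_Pol h] a nv by blast
      qed
      moreover have "R y = (- S y) * F y + [:a y ^ k:] * H y" for y
        using R(2)[of y] by (simp add: algebra_simps)
      ultimately have "J D R" using R(1) unfolding J_def by blast
      then show ?thesis by blast
    qed
    define n where "n = (LEAST n. \<exists>G. J n G)"
    have "n \<le> D" 
    proof -
      obtain l G where "l \<le> D" "J l G" using J_D by blast
      then show ?thesis unfolding n_def by (intro order_trans[OF Least_le[of _ l]]) auto
    qed
    from J_D have "\<exists>n. \<exists>G. J n G" by blast
    from LeastI_ex[OF this] obtain G where "J n G" unfolding n_def by blast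
    have n_minimal: "\<not> J l R" if "l < n" for l R
      using that not_less_Least[of l "\<lambda>n. \<exists>G. J n G"] unfolding n_def by blast
    have "n \<noteq> 0" using \<open>J n G\<close> by (auto simp: J_def nz_def fam_def van_def)
    then obtain d where d: "n = Suc d" by (cases n) auto
    have G: "G \<in> fam U (Suc d)" "nz G" and
      G_comb: "\<And>y. y \<in> proj_closure U \<Longrightarrow> \<exists>u v. G y = u * F y + v * H y"
      using \<open>J n G\<close> by (auto simp: J_def d)
    define g where "g x = coeff (G x) d" for x
    have g_Pol: "g \<in> Pol U" unfolding g_def by (rule fam_coeff[OF G(1)])
    have g: "\<not> van g"
    proof
      assume *: "van g"
      let ?G = "\<lambda>x. G x - monom (coeff (G x) d) d"
      have eq: "?G y = G y" if "y \<in> proj_closure U" for y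
        using * that g_Pol by (auto simp: proj_closure_def g_def)
      have "nz ?G"
      proof (rule ccontr)
        assume "\<not> nz ?G"
        then have "G x = 0" if "x \<in> V" for x using nzD[OF _ that] eq V_subset_proj_closure that by fastforce
        then show False using G(2) by (auto simp: nz_def van_def)
      qed
      then have "J d ?G" using fam_truncate[OF G(1)] G_comb eq unfolding J_def by auto
      then show False using n_minimal[of d] d by blast
    qed
    \<comment> \<open>F and H are coprime: otherwise pseudo-division of F by G leaves no remainder,
      so by primeness G or S vanishes on V after substitution. Both have degree below D; for G this
      contradicts the minimality of F, and for S it forces all coefficients to vanish, hence g ^ k *
      a as well.\<close>
    have "d = 0"
    proof (rule ccontr)
      assume "d \<noteq> 0"
      obtain k S R where S: "S \<in> fam U (Suc D - d)" and R: "R \<in> fam U d"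
        "\<And>x. smult (g x ^ k) (F x) = G x * S x + R x"
        using fam_pseudo_division[OF G(1) F(1)] unfolding g_def by blast
      have "\<exists>u v. R y = u * F y + v * H y" if y: "y \<in> proj_closure U" for y
      proof -
        obtain u v where "G y = u * F y + v * H y" using G_comb[OF y] by blast
        then have "R y = ([:g y ^ k:] - u * S y) * F y + (- v * S y) * H y"
          using R(2)[of y] by (simp add: algebra_simps)
        then show ?thesis by blast
      qed
      then have R0: "\<not> nz R" using n_minimal[of d R] R(1) d unfolding J_def by blast
      have "van (\<lambda>x. ev G x * ev S x)"
        unfolding van_def
      proof
        fix x assume x: "x \<in> V"
        have "ev G x * ev S x = poly (smult (g x ^ k) (F x)) (x $ j)"
          unfolding R(2) using nzD[OF R0 x] by (simp add: ev_def)
        also have "\<dots> = 0" using F(2) x by (simp add: van_def ev_def)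
        finally show "ev G x * ev S x = 0" .
      qed
      then have "van (ev G) \<or> van (ev S)" by (rule van_mult[OF ev_Pol[OF G(1)] ev_Pol[OF S]])
      then show False
      proof
        assume "van (ev G)"
        then show False using minimal[OF G(1)] G(2) \<open>n \<le> D\<close> d by simp
      next
        assume "van (ev S)"
        then have S0: "\<not> nz S" using minimal[OF S] \<open>d \<noteq> 0\<close> by simp
        have "van (\<lambda>x. g x ^ k * a x)"
          unfolding van_def
        proof
          fix x assume x: "x \<in> V"
          have "g x ^ k * a x = coeff (smult (g x ^ k) (F x)) D" by (simp add: a_def)
          also have "\<dots> = 0" unfolding R(2) using nzD[OF R0 x] nzD[OF S0 x] by simp
          finally show "g x ^ k * a x = 0" .
        qed
        then show False using van_power_mult[OF g_Pol a_Pol] a g by blast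
      qed
    qed
    have G_const: "G y = [:g y:]" for y
      using fam_zero[OF G(1)] \<open>d = 0\<close>
      by (intro poly_eqI) (auto simp: g_def coeff_pCons split: nat.split)
    show ?thesis
    \<comment> \<open>Where \<open>a\<close> is nonzero, \<open>F y\<close> has positive degree and
      hence a root; where \<open>g\<close> is nonzero, the identity g = u F + v H keeps H from
      vanishing at that root.\<close>
    proof (intro bexI[of _ "\<lambda>x. g x * a x"] conjI ballI impI)
      show "(\<lambda>x. g x * a x) \<in> Pol U" by (intro Pol_intros g_Pol a_Pol)
      show "\<not> van (\<lambda>x. g x * a x)" using van_mult[OF g_Pol a_Pol] g a by blast
      fix y assume y: "y \<in> proj_closure U" "g y * a y \<noteq> 0"
      have "degree (F y) \<noteq> 0"
        using le_degree[of "F y" D] y(2) \<open>D \<noteq> 0\<close> by (auto simp: a_def)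
      then obtain \<xi> where \<xi>: "poly (F y) \<xi> = 0" using alg_closed_imp_poly_has_root by blast
      obtain u v where "G y = u * F y + v * H y" using G_comb[OF y(1)] by blast
      then have "poly (G y) \<xi> = poly (u * F y + v * H y) \<xi>" by simp
      then have "g y = poly v \<xi> * poly (H y) \<xi>" using \<xi> by (simp add: G_const)
      then have "h (up y \<xi>) \<noteq> 0" using y(2) ev_up[OF H(1)] H(2) by auto
      \<comment> \<open>By minimality of F the pseudo-remainder of any vanishing P is zero, so P
        vanishes at the root of \<open>F y\<close> once the power of \<open>a y\<close> is
        cancelled.\<close>
      moreover have "up y \<xi> \<in> proj_closure (insert j U)"
      proof (rule in_closure)
        fix P l assume P: "P \<in> fam U l" "van (ev P)"
        obtain k S R where R: "R \<in> fam U D" "\<And>x. smult (a x ^ k) (P x) = F x * S x + R x"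
          using fam_pseudo_division[OF F(1) P(1)] unfolding a_def by blast
        have "van (ev R)"
          unfolding van_def
        proof
          fix x assume x: "x \<in> V"
          have "poly (smult (a x ^ k) (P x)) (x $ j) = poly (F x * S x + R x) (x $ j)" by (simp only: R(2))
          then show "ev R x = 0" using F(2) P(2) x by (simp add: van_def ev_def)
        qed
        then have "R y = 0" using minimal[OF R(1)] nz_closure[OF R(1) _ y(1)] by simp
        then have "poly (smult (a y ^ k) (P y)) \<xi> = 0" by (simp add: R(2) \<xi>)
        then show "poly (P y) \<xi> = 0" using y(2) by simp
      qed
      ultimately show "\<exists>y'\<in>proj_closure (insert j U). (\<forall>i\<in>U. y' $ i = y $ i) \<and> h y' \<noteq> 0"
        using up(2) by (intro bexI[of _ "up y \<xi>"]) auto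
    qed
  qed
qed

text \<open>Coordinates are dropped one at a time; the function obtained for one coordinate is the
  function to be kept nonzero when the next one is treated. This is why the single step carries an
  arbitrary \<open>h\<close>.\<close>

lemma extension:
  assumes "finite W" "h \<in> Pol (U \<union> W)" "\<not> van h" "U \<inter> W = {}"
  shows "\<exists>h'\<in>Pol U. \<not> van h' \<and> (\<forall>y\<in>proj_closure U. h' y \<noteq> 0 \<longrightarrow>
           (\<exists>y'\<in>proj_closure (U \<union> W). (\<forall>i\<in>U. y' $ i = y $ i) \<and> h y' \<noteq> 0))"
  using assms
proof (induction W arbitrary: h rule: finite_induct)
  case empty
  then show ?case by auto
next
  case (insert j W)
  have eq: "U \<union> insert j W = insert j (U \<union> W)" by simp
  have "j \<notin> U \<union> W" "h \<in> Pol (insert j (U \<union> W))" using insert by auto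
  from extension_step[OF this insert.prems(2)] obtain h1 where h1: "h1 \<in> Pol (U \<union> W)" "\<not> van h1"
    "\<And>y. y \<in> proj_closure (U \<union> W) \<Longrightarrow> h1 y \<noteq> 0 \<Longrightarrow> 
      \<exists>y'\<in>proj_closure (insert j (U \<union> W)). (\<forall>i\<in>U \<union> W. y' $ i = y $ i) \<and> h y' \<noteq> 0" by blast
  from insert.IH[OF h1(1,2)] insert.prems(3) obtain h' where h': "h' \<in> Pol U" "\<not> van h'"
    "\<And>y. y \<in> proj_closure U \<Longrightarrow> h' y \<noteq> 0 \<Longrightarrow>
      \<exists>y'\<in>proj_closure (U \<union> W). (\<forall>i\<in>U. y' $ i = y $ i) \<and> h1 y' \<noteq> 0" by auto
  show ?case
    unfolding eq
  proof (intro bexI[of _ h'] conjI ballI impI h')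
    fix y assume "y \<in> proj_closure U" "h' y \<noteq> 0"
    then obtain y1 where y1: "y1 \<in> proj_closure (U \<union> W)" "\<forall>i\<in>U. y1 $ i = y $ i" "h1 y1 \<noteq> 0"
      using h'(3) by blast
    then obtain y2 where "y2 \<in> proj_closure (insert j (U \<union> W))" "\<forall>i\<in>U \<union> W. y2 $ i = y1 $ i" "h y2 \<noteq> 0"
      using h1(3) by blast
    with y1 show "\<exists>y'\<in>proj_closure (insert j (U \<union> W)). (\<forall>i\<in>U. y' $ i = y $ i) \<and> h y' \<noteq> 0"
      by (intro bexI[of _ y2]) auto
  qed
qed

lemma proj_closure_UNIV: "zariski_closed V \<Longrightarrow> proj_closure UNIV = V"
  using zariski_closed_separate[of V] V_subset_proj_closure
  by (fastforce simp: proj_closure_def van_def)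

text \<open>If two coordinates were algebraically independent on \<open>V\<close>, generic points of a line
  \<open>x $ i = c\<close> in their coordinate plane would all lift to \<open>V\<close>.\<close>

lemma coordinates_dependent:
  assumes closed: "zariski_closed V" and "i \<noteq> j"
    and fibre: "\<And>c. \<not> van (\<lambda>x. x $ i - c) \<Longrightarrow> finite {x \<in> V. x $ i = c}"
  shows "\<exists>f\<in>Pol {i, j}. van f \<and> (\<exists>x. f x \<noteq> 0)"
proof (rule ccontr)
  assume "\<not> ?thesis"
  then have indep: "f x = 0" if "f \<in> Pol {i, j}" "van f" for f x using that by blast
  then have closure: "y \<in> proj_closure {i, j}" for y by (auto simp: proj_closure_def)
  have not_van: "\<not> van (\<lambda>_. 1)" using indep[of "\<lambda>_. 1"] Pol_const[of 1 "{i, j}"] by auto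
  have "{i, j} \<union> - {i, j} = UNIV" by auto
  \<comment> \<open>With the constant 1 the extension property asks only for a lift, and the lift
    lies in V itself because V is closed.\<close>
  with extension[of "- {i, j}" "\<lambda>_. 1" "{i, j}"] not_van Pol_const obtain h where h: "h \<in> Pol {i, j}" "\<not> van h"
    "\<And>y. h y \<noteq> 0 \<Longrightarrow> \<exists>y'\<in>V. \<forall>l\<in>{i, j}. y' $ l = y $ l"
    using closure proj_closure_UNIV[OF closed] by (auto simp: Pol_const)
  from h(2) obtain a where a: "h a \<noteq> 0" unfolding van_def by blast
  \<comment> \<open>Along the line through a in direction j, h is a nonzero polynomial in s, so all
    but finitely many points lift; the lifts are distinct and share the coordinate a $ i.\<close>
  define S where "S = {s. h (a + s *s axis j 1) \<noteq> 0}"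
  have "h (a + 0 *s axis j 1) \<noteq> 0" using a by simp
  then have "finite (- S)"
    using Pol_zero_on_line[OF h(1), of a "axis j 1" 0] unfolding S_def by (auto simp: Compl_eq)
  then have "infinite S" using infinite_UNIV_char_0 by (metis Compl_partition finite_UnI)
  have "\<exists>y\<in>V. y $ i = a $ i \<and> y $ j = a $ j + s" if "s \<in> S" for s
    using h(3)[of "a + s *s axis j 1"] that \<open>i \<noteq> j\<close> by (auto simp: S_def axis_def)
  then obtain p where p: "\<And>s. s \<in> S \<Longrightarrow> p s \<in> V \<and> p s $ i = a $ i \<and> p s $ j = a $ j + s" by metis
  have "inj_on p S" by (rule inj_onI) (metis p add_left_cancel)
  then have "infinite (p ` S)" using \<open>infinite S\<close> finite_image_iff by blast
  moreover have "p ` S \<subseteq> {x \<in> V. x $ i = a $ i}" using p by auto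
  ultimately have "infinite {x \<in> V. x $ i = a $ i}" using finite_subset by blast
  with fibre have "van (\<lambda>x. x $ i - a $ i)" by blast
  \<comment> \<open>Vanishing of x $ i - a $ i on V is itself a forbidden relation; it is refuted by
    evaluation at a point off the fibre.\<close>
  then have "(a + axis i 1) $ i - a $ i = 0" by (intro indep) (auto intro!: Pol_intros)
  then show False by (simp add: axis_def)
qed

end

section \<open>Zeros of functions on a curve\<close>

text \<open>Gaussian elimination on equations \<open>G\<close> with unknowns \<open>I\<close>: a
  pivot i0 removes the equation b, and the unknown at i0 is recovered afterwards by back
  substitution.\<close>

lemma homogeneous_system:
  fixes m :: "'i \<Rightarrow> 'b \<Rightarrow> 'k::field"
  assumes "finite G" "finite I" "card G < card I"
  shows "\<exists>c. (\<exists>i\<in>I. c i \<noteq> 0) \<and> (\<forall>b\<in>G. (\<Sum>i\<in>I. c i * m i b) = 0)"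
  using assms
proof (induction G arbitrary: I m rule: finite_induct)
  case empty
  then obtain i where "i \<in> I" by (metis card_gt_0_iff equals0I card.empty)
  then show ?case by (intro exI[of _ "\<lambda>_. 1"]) auto
next
  case (insert b G)
  show ?case
  proof (cases "\<forall>i\<in>I. m i b = 0")
    case True
    have "card G < card I" using insert by simp
    from insert.IH[OF insert.prems(1) this] obtain c
      where c: "\<exists>i\<in>I. c i \<noteq> 0" "\<forall>b\<in>G. (\<Sum>i\<in>I. c i * m i b) = 0" by blast
    then show ?thesis using True by (intro exI[of _ c]) auto
  next
    case False
    then obtain i0 where i0: "i0 \<in> I" "m i0 b \<noteq> 0" by blast
    define r where "r i = m i b / m i0 b" for i
    have "card G < card (I - {i0})" using insert i0 by simp
    from insert.IH[OF _ this, of "\<lambda>i b. m i b - r i * m i0 b"] insert.prems obtain c where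
      c: "\<exists>i\<in>I - {i0}. c i \<noteq> 0" "\<And>b. b \<in> G \<Longrightarrow> (\<Sum>i\<in>I - {i0}. c i * (m i b - r i * m i0 b)) = 0" by auto
    define c' where "c' = c(i0 := - (\<Sum>i\<in>I - {i0}. c i * r i))"
    have sum: "(\<Sum>i\<in>I. c' i * m i x) = (\<Sum>i\<in>I - {i0}. c i * (m i x - r i * m i0 x))" for x
    proof -
      have "(\<Sum>i\<in>I - {i0}. c' i * m i x) = (\<Sum>i\<in>I - {i0}. c i * m i x)"
        by (rule sum.cong) (auto simp: c'_def)
      then have "(\<Sum>i\<in>I. c' i * m i x) = (\<Sum>i\<in>I - {i0}. c i * m i x) - (\<Sum>i\<in>I - {i0}. c i * r i) * m i0 x"
        using i0 insert.prems by (simp add: sum.remove[of I i0] c'_def)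
      then show ?thesis
        by (simp add: sum_subtractf right_diff_distrib sum_distrib_right mult.assoc)
    qed
    have "(\<Sum>i\<in>I. c' i * m i x) = 0" if "x \<in> insert b G" for x
    proof (cases "x = b")
      case True
      then show ?thesis unfolding sum using i0(2) by (simp add: r_def)
    next
      case False
      then show ?thesis unfolding sum using c(2) that by simp
    qed
    moreover have "\<exists>i\<in>I. c' i \<noteq> 0" using c(1) by (auto simp: c'_def)
    ultimately show ?thesis by blast
  qed
qed

text \<open>For each y some coordinate distinguishes it from z; the product of these linear factors
  is a Lagrange function, up to its nonzero value at z.\<close>

lemma Pol_separate_points:
  fixes z :: "'k::field ^ 'm::finite"
  assumes "finite S"
  obtains h where "h \<in> Pol UNIV" "h z \<noteq> 0" "\<And>y. y \<in> S - {z} \<Longrightarrow> h y = 0"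
proof -
  have "\<exists>i. y $ i \<noteq> z $ i" if "y \<in> S - {z}" for y using that by (auto simp: vec_eq_iff)
  then obtain c where c: "\<And>y. y \<in> S - {z} \<Longrightarrow> y $ c y \<noteq> z $ c y" by metis
  show ?thesis
  proof (rule that)
    show "(\<lambda>x. \<Prod>y\<in>S - {z}. x $ c y - y $ c y) \<in> Pol UNIV" by (intro Pol_intros) auto
    show "(\<Prod>y\<in>S - {z}. z $ c y - y $ c y) \<noteq> 0" using assms c by (force simp: prod_zero_iff)
    show "(\<Prod>y\<in>S - {z}. x $ c y - y $ c y) = 0" if "x \<in> S - {z}" for x
      using assms that by (intro prod_zero) auto
  qed
qed

section \<open>Algebraic relations over one coordinate\<close>

context prime_locus
begin

text \<open>A dependence between x_i and x_j is read as a polynomial in x_j, with D the largest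
  index whose coefficient is a nonzero polynomial in x_i. D = 0 would leave a relation for x_i
  alone, which \<open>trans\<close> excludes.\<close>

lemma coordinate_relation:
  assumes closed: "zariski_closed V" and "infinite V"
    and fibre: "\<And>i c. \<not> van (\<lambda>x. x $ i - c) \<Longrightarrow> finite {x \<in> V. x $ i = c}"
    and trans: "\<And>q. van (\<lambda>x. poly q (x $ i)) \<Longrightarrow> q = 0"
  shows "\<exists>D a p. D > 0 \<and> a \<noteq> 0 \<and>
           (\<forall>x\<in>V. poly a (x $ i) * x $ j ^ D = (\<Sum>l<D. poly (p l) (x $ i) * x $ j ^ l))"
proof (cases "j = i")
  case True
  \<comment> \<open>The trivial relation x_i = x_i, with D = 1, a = 1 and the identity polynomial as
    the only coefficient.\<close>
  then show ?thesis
    by (intro exI[of _ 1] exI[of _ "\<lambda>_. [:0, 1:]"]) auto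
next
  case False
  then have "i \<noteq> j" by simp
  then obtain f x0 where f: "f \<in> Pol (insert j {i})" "van f" "f x0 \<noteq> 0"
    using coordinates_dependent[OF closed \<open>i \<noteq> j\<close> fibre] by (auto simp: insert_commute)
  from Pol_insert_fam[OF f(1)] obtain n F where F: "F \<in> fam {i} n" "f = (\<lambda>x. poly (F x) (x $ j))" by blast
  have "\<exists>q. (\<lambda>x. coeff (F x) l) = (\<lambda>x. poly q (x $ i))" for l
    by (rule Pol_singleton[OF fam_coeff[OF F(1)]])
  then obtain q where "\<And>l. (\<lambda>x. coeff (F x) l) = (\<lambda>x. poly (q l) (x $ i))" by metis
  then have q: "coeff (F x) l = poly (q l) (x $ i)" for x l by meson
  have q0: "q l = 0" if "n \<le> l" for l
  proof -
    have "poly (q l) s = 0" for s using fam_zero[OF F(1) that, of "\<chi> _. s"] by (simp add: q)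
    then show ?thesis by (simp add: poly_all_0_iff_0[symmetric])
  qed
  then have "{l. q l \<noteq> 0} \<subseteq> {..<n}" using leI by blast
  then have fin: "finite {l. q l \<noteq> 0}" by (rule finite_subset) simp
  have "{l. q l \<noteq> 0} \<noteq> {}"
  proof
    assume "{l. q l \<noteq> 0} = {}"
    then have "F x0 = 0" by (intro poly_eqI) (auto simp: q)
    then show False using f(3) F(2) by simp
  qed
  define D where "D = Max {l. q l \<noteq> 0}"
  have D: "q D \<noteq> 0" "\<And>l. D < l \<Longrightarrow> q l = 0"
    using Max_in[OF fin \<open>{l. q l \<noteq> 0} \<noteq> {}\<close>] Max_ge[OF fin] unfolding D_def by fastforce+
  have rel: "poly (q D) (x $ i) * x $ j ^ D = (\<Sum>l<D. poly (- q l) (x $ i) * x $ j ^ l)" if x: "x \<in> V" for x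
  proof -
    have "0 = (\<Sum>l<Suc D. coeff (F x) l * x $ j ^ l)"
      using f(2) x poly_eq_sum_lessThan[of "Suc D" "F x" "x $ j"] D(2) unfolding F(2) van_def by (simp add: q)
    then show ?thesis by (simp add: q sum_negf eq_neg_iff_add_eq_0 add.commute)
  qed
  have "D \<noteq> 0"
  proof
    assume "D = 0"
    then have "van (\<lambda>x. poly (q D) (x $ i))" using rel by (auto simp: van_def)
    then show False using trans D(1) by blast
  qed
  then show ?thesis using D(1) rel by (intro exI[of _ D] exI[of _ "q D"] exI[of _ "\<lambda>l. - q l"]) auto
qed

end

text \<open>Over the parameter \<open>x $ i\<close>, the monomials with exponents below \<open>D\<close> span all functions on \<open>V\<close> up to
  denominators dividing powers of \<open>\<Prod>j. a j\<close>.\<close>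

locale curve_relations = prime_locus V
  for V :: "('k::{alg_closed_field, field_char_0} ^ 'm::finite) set" +
  fixes i :: 'm and D :: "'m \<Rightarrow> nat" and a :: "'m \<Rightarrow> 'k poly" and p :: "'m \<Rightarrow> nat \<Rightarrow> 'k poly"
  assumes trans: "van (\<lambda>x. poly q (x $ i)) \<Longrightarrow> q = 0"
    and D_pos: "D j > 0" and a_nonzero: "a j \<noteq> 0"
    and relation: "x \<in> V \<Longrightarrow> poly (a j) (x $ i) * x $ j ^ D j = (\<Sum>l<D j. poly (p j l) (x $ i) * x $ j ^ l)"
begin

definition box :: "('m \<Rightarrow> nat) set" where "box = Pi\<^sub>E UNIV (\<lambda>j. {..<D j})"

definition mon :: "('m \<Rightarrow> nat) \<Rightarrow> 'k ^ 'm \<Rightarrow> 'k" where "mon \<beta> x = (\<Prod>j\<in>UNIV. x $ j ^ \<beta> j)"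

text \<open>The source of the dimension count: a member is described by card box * (d + 1)
  coefficients. They need not be unique, and only values on V are compared.\<close>

definition lat :: "nat \<Rightarrow> ('k ^ 'm \<Rightarrow> 'k) set" where
  "lat d = {f. \<exists>q. (\<forall>\<beta>\<in>box. degree (q \<beta>) \<le> d) \<and>
     (\<forall>x\<in>V. f x = (\<Sum>\<beta>\<in>box. poly (q \<beta>) (x $ i) * mon \<beta> x))}"

definition denom :: "'k poly" where "denom = (\<Prod>j\<in>UNIV. a j)"

lemma finite_box: "finite box"
  unfolding box_def by (intro finite_PiE) auto

lemma box_iff: "\<beta> \<in> box \<longleftrightarrow> (\<forall>j. \<beta> j < D j)"
  by (auto simp: box_def)

lemma mon_upd: "mon (\<beta>(j := n)) x = x $ j ^ n * (\<Prod>l\<in>UNIV - {j}. x $ l ^ \<beta> l)"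
proof -
  have "mon (\<beta>(j := n)) x = x $ j ^ n * (\<Prod>l\<in>UNIV - {j}. x $ l ^ (\<beta>(j := n)) l)"
    unfolding mon_def by (subst prod.remove[of UNIV j]) auto
  also have "(\<Prod>l\<in>UNIV - {j}. x $ l ^ (\<beta>(j := n)) l) = (\<Prod>l\<in>UNIV - {j}. x $ l ^ \<beta> l)"
    by (rule prod.cong) auto
  finally show ?thesis .
qed

lemma lat_cong: "f \<in> lat d \<Longrightarrow> (\<And>x. x \<in> V \<Longrightarrow> g x = f x) \<Longrightarrow> g \<in> lat d"
  by (auto simp: lat_def)

lemma lat_0: "(\<lambda>_. 0) \<in> lat d"
  unfolding lat_def by (intro CollectI exI[of _ "\<lambda>_. 0"]) auto

lemma lat_add:
  assumes "f \<in> lat d" "g \<in> lat d"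
  shows "(\<lambda>x. f x + g x) \<in> lat d"
proof -
  obtain q r where
    "\<forall>\<beta>\<in>box. degree (q \<beta>) \<le> d" "\<forall>x\<in>V. f x = (\<Sum>\<beta>\<in>box. poly (q \<beta>) (x $ i) * mon \<beta> x)"
    "\<forall>\<beta>\<in>box. degree (r \<beta>) \<le> d" "\<forall>x\<in>V. g x = (\<Sum>\<beta>\<in>box. poly (r \<beta>) (x $ i) * mon \<beta> x)"
    using assms unfolding lat_def by auto
  then show ?thesis unfolding lat_def
    by (intro CollectI exI[of _ "\<lambda>\<beta>. q \<beta> + r \<beta>"]) (auto intro: degree_add_le simp: distrib_right sum.distrib)
qed

lemma lat_sum: "(\<And>s. s \<in> S \<Longrightarrow> f s \<in> lat d) \<Longrightarrow> (\<lambda>x. \<Sum>s\<in>S. f s x) \<in> lat d"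
  by (induction S rule: infinite_finite_induct) (auto intro: lat_0 lat_add)

lemma lat_poly_mult:
  assumes "f \<in> lat d" "d + degree r \<le> d'"
  shows "(\<lambda>x. poly r (x $ i) * f x) \<in> lat d'"
proof -
  obtain q where q: "\<And>\<beta>. \<beta> \<in> box \<Longrightarrow> degree (q \<beta>) \<le> d"
    "\<And>x. x \<in> V \<Longrightarrow> f x = (\<Sum>\<beta>\<in>box. poly (q \<beta>) (x $ i) * mon \<beta> x)"
    using assms unfolding lat_def by auto
  have "degree (r * q \<beta>) \<le> d'" if "\<beta> \<in> box" for \<beta>
    using degree_mult_le[of r "q \<beta>"] q(1)[OF that] assms(2) by simp
  then show ?thesis unfolding lat_def
    by (intro CollectI exI[of _ "\<lambda>\<beta>. r * q \<beta>"]) (auto simp: q(2) sum_distrib_left mult.assoc)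
qed

lemma lat_mon:
  assumes "\<beta> \<in> box"
  shows "mon \<beta> \<in> lat 0"
proof -
  have "(\<Sum>\<gamma>\<in>box. poly (if \<gamma> = \<beta> then 1 else 0) (x $ i) * mon \<gamma> x)
      = (\<Sum>\<gamma>\<in>box. if \<gamma> = \<beta> then mon \<gamma> x else 0)" for x
    by (intro sum.cong) auto
  then show ?thesis unfolding lat_def using assms finite_box
    by (intro CollectI exI[of _ "\<lambda>\<gamma>. if \<gamma> = \<beta> then 1 else 0"]) auto
qed

text \<open>Multiplication by x_j raises one exponent. When it leaves the box, it has become D j,
  and the relation for x_j lowers it at the cost of the factor \<open>a j\<close>; the remaining
  factors of \<open>denom\<close> are carried along so that one denominator serves all j.\<close>

lemma lat_var_mon:
  assumes \<beta>: "\<beta> \<in> box"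
  shows "\<exists>c. (\<lambda>x. poly denom (x $ i) * (x $ j * mon \<beta> x)) \<in> lat c"
proof (cases "Suc (\<beta> j) < D j")
  case True
  then have "\<beta>(j := Suc (\<beta> j)) \<in> box" using \<beta> by (auto simp: box_iff)
  moreover have "x $ j * mon \<beta> x = mon (\<beta>(j := Suc (\<beta> j))) x" for x
    using mon_upd[of \<beta> j "\<beta> j" x] mon_upd[of \<beta> j "Suc (\<beta> j)" x] by simp
  ultimately have "(\<lambda>x. poly denom (x $ i) * (x $ j * mon \<beta> x)) \<in> lat (degree denom)"
    by (simp add: lat_poly_mult[OF lat_mon])
  then show ?thesis by blast
next
  case False
  then have eq: "Suc (\<beta> j) = D j" using \<beta> by (metis box_iff Suc_lessI)
  define b where "b = (\<Prod>l\<in>UNIV - {j}. a l)"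
  have denom: "denom = a j * b" unfolding denom_def b_def by (rule prod.remove) auto
  define c where "c = (\<Sum>l<D j. degree (b * p j l))"
  have "(\<lambda>x. poly (b * p j l) (x $ i) * mon (\<beta>(j := l)) x) \<in> lat c" if "l < D j" for l
  proof (rule lat_poly_mult)
    show "mon (\<beta>(j := l)) \<in> lat 0" using \<beta> that by (intro lat_mon) (auto simp: box_iff)
    show "0 + degree (b * p j l) \<le> c"
      using member_le_sum[of l "{..<D j}" "\<lambda>l. degree (b * p j l)"] that unfolding c_def by simp
  qed
  then have "(\<lambda>x. \<Sum>l<D j. poly (b * p j l) (x $ i) * mon (\<beta>(j := l)) x) \<in> lat c" by (intro lat_sum) auto
  moreover have "poly denom (x $ i) * (x $ j * mon \<beta> x)
      = (\<Sum>l<D j. poly (b * p j l) (x $ i) * mon (\<beta>(j := l)) x)" if "x \<in> V" for x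
  proof -
    let ?r = "\<Prod>l\<in>UNIV - {j}. x $ l ^ \<beta> l"
    have "x $ j * mon \<beta> x = x $ j ^ D j * ?r"
      using mon_upd[of \<beta> j "\<beta> j" x] by (simp add: eq[symmetric])
    then have "poly denom (x $ i) * (x $ j * mon \<beta> x)
        = poly b (x $ i) * (poly (a j) (x $ i) * x $ j ^ D j) * ?r"
      by (simp add: denom mult_ac)
    then show ?thesis
      unfolding relation[OF that] mon_upd by (simp add: sum_distrib_left sum_distrib_right mult_ac)
  qed
  ultimately show ?thesis using lat_cong by meson
qed

lemma lat_var: "\<exists>C. degree denom \<le> C \<and>
  (\<forall>j d. \<forall>g\<in>lat d. (\<lambda>x. poly denom (x $ i) * (x $ j * g x)) \<in> lat (d + C))"
proof -
  define c where "c j \<beta> = (SOME c. (\<lambda>x. poly denom (x $ i) * (x $ j * mon \<beta> x)) \<in> lat c)" for j \<beta>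
  have c: "(\<lambda>x. poly denom (x $ i) * (x $ j * mon \<beta> x)) \<in> lat (c j \<beta>)" if "\<beta> \<in> box" for j \<beta>
    unfolding c_def by (rule someI_ex[OF lat_var_mon[OF that]])
  define C where "C = degree denom + (\<Sum>j\<in>UNIV. \<Sum>\<beta>\<in>box. c j \<beta>)"
  have c_le: "c j \<beta> \<le> C" if "\<beta> \<in> box" for j \<beta>
  proof -
    have "c j \<beta> \<le> (\<Sum>\<beta>\<in>box. c j \<beta>)" using that finite_box by (intro member_le_sum) auto
    also have "\<dots> \<le> (\<Sum>j\<in>UNIV. \<Sum>\<beta>\<in>box. c j \<beta>)" by (intro member_le_sum) auto
    finally show ?thesis unfolding C_def by simp
  qed
  have "(\<lambda>x. poly denom (x $ i) * (x $ j * g x)) \<in> lat (d + C)" if g: "g \<in> lat d" for j d g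
  proof -
    obtain q where q: "\<And>\<beta>. \<beta> \<in> box \<Longrightarrow> degree (q \<beta>) \<le> d"
      "\<And>x. x \<in> V \<Longrightarrow> g x = (\<Sum>\<beta>\<in>box. poly (q \<beta>) (x $ i) * mon \<beta> x)"
      using g unfolding lat_def by auto
    have "(\<lambda>x. poly (q \<beta>) (x $ i) * (poly denom (x $ i) * (x $ j * mon \<beta> x))) \<in> lat (d + C)" if "\<beta> \<in> box" for \<beta>
      by (rule lat_poly_mult[OF c[OF that]]) (use q(1)[OF that] c_le[OF that, of j] in simp)
    then have "(\<lambda>x. \<Sum>\<beta>\<in>box. poly (q \<beta>) (x $ i) * (poly denom (x $ i) * (x $ j * mon \<beta> x))) \<in> lat (d + C)"
      by (rule lat_sum)
    then show ?thesis by (rule lat_cong) (simp add: q(2) sum_distrib_left mult_ac)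
  qed
  then show ?thesis by (intro exI[of _ C]) (auto simp: C_def)
qed

definition C :: nat where
  "C = (SOME C. degree denom \<le> C \<and> (\<forall>j d. \<forall>g\<in>lat d. (\<lambda>x. poly denom (x $ i) * (x $ j * g x)) \<in> lat (d + C)))"

lemma C_ge: "degree denom \<le> C"
  and lat_var_C: "g \<in> lat d \<Longrightarrow> (\<lambda>x. poly denom (x $ i) * (x $ j * g x)) \<in> lat (d + C)"
  using someI_ex[OF lat_var] unfolding C_def by blast+

text \<open>A substitute for the filtration by degree.\<close>

definition filt :: "nat \<Rightarrow> ('k ^ 'm \<Rightarrow> 'k) set" where
  "filt e = {f. \<forall>d. \<forall>g\<in>lat d. (\<lambda>x. poly denom (x $ i) ^ e * (f x * g x)) \<in> lat (d + C * e)}"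

lemma filtD: "f \<in> filt e \<Longrightarrow> g \<in> lat d \<Longrightarrow> (\<lambda>x. poly denom (x $ i) ^ e * (f x * g x)) \<in> lat (d + C * e)"
  by (auto simp: filt_def)

lemma filt_const: "(\<lambda>_. c) \<in> filt 0"
  unfolding filt_def using lat_poly_mult[of _ _ "[:c:]"] by auto

lemma filt_var: "(\<lambda>x. x $ j) \<in> filt 1"
  unfolding filt_def using lat_var_C by auto

lemma filt_le:
  assumes "f \<in> filt e" "e \<le> e'"
  shows "f \<in> filt e'"
  using assms(2)
proof (induction e' rule: dec_induct)
  case base
  show ?case by (rule assms(1))
next
  case (step n)
  show ?case unfolding filt_def
  proof (intro CollectI allI ballI)
    fix d g assume "g \<in> lat d"
    from lat_poly_mult[OF filtD[OF step.IH this], of denom "d + C * Suc n"] C_ge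
    show "(\<lambda>x. poly denom (x $ i) ^ Suc n * (f x * g x)) \<in> lat (d + C * Suc n)" by (simp add: mult.assoc)
  qed
qed

lemma filt_add:
  assumes "f \<in> filt e" "g \<in> filt e"
  shows "(\<lambda>x. f x + g x) \<in> filt e"
  unfolding filt_def
proof (intro CollectI allI ballI)
  fix d h assume h: "h \<in> lat d"
  from lat_add[OF filtD[OF assms(1) h] filtD[OF assms(2) h]]
  show "(\<lambda>x. poly denom (x $ i) ^ e * ((f x + g x) * h x)) \<in> lat (d + C * e)"
    by (simp add: distrib_left distrib_right)
qed

text \<open>\<open>filt\<close> constrains multiplication by f as an operator on every
  \<open>lat d\<close>; operators compose, so denominator exponents and degree shifts add
  up.\<close>

lemma filt_mult:
  assumes "f \<in> filt e" "g \<in> filt e'"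
  shows "(\<lambda>x. f x * g x) \<in> filt (e + e')"
  unfolding filt_def
proof (intro CollectI allI ballI)
  fix d h assume h: "h \<in> lat d"
  from filtD[OF assms(1) filtD[OF assms(2) h]]
  show "(\<lambda>x. poly denom (x $ i) ^ (e + e') * (f x * g x * h x)) \<in> lat (d + C * (e + e'))"
    by (simp add: power_add algebra_simps)
qed

lemma filt_power: "f \<in> filt e \<Longrightarrow> (\<lambda>x. f x ^ n) \<in> filt (e * n)"
  by (induction n) (auto intro: filt_const dest: filt_mult)

text \<open>Translation changes a coordinate by a constant, and constants lie in
  \<open>filt 0\<close> whatever their value. Hence the exponent found for the generators, and then
  for sums and products, is the same for all u.\<close>

lemma filt_translates: "f \<in> Pol U \<Longrightarrow> \<exists>e. \<forall>u. (\<lambda>x. f (x - u)) \<in> filt e"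
proof (induction rule: Pol.induct)
  case (Pol_const c)
  then show ?case using filt_const by blast
next
  case (Pol_var j)
  have "(\<lambda>x. (x - u) $ j) \<in> filt 1" for u
    using filt_add[OF filt_var[of j] filt_le[OF filt_const[of "- u $ j"]]] by simp
  then show ?case by blast
next
  case (Pol_add f g)
  then obtain e e' where "\<And>u. (\<lambda>x. f (x - u)) \<in> filt e" "\<And>u. (\<lambda>x. g (x - u)) \<in> filt e'" by blast
  then have "(\<lambda>x. f (x - u) + g (x - u)) \<in> filt (max e e')" for u
    by (intro filt_add filt_le[of _ e "max e e'"] filt_le[of _ e' "max e e'"]) auto
  then show ?case by blast
next
  case (Pol_mult f g)
  then show ?case using filt_mult by blast
qed

text \<open>Uniqueness of an f-adic expansion: on S only the term g 0 survives, so it vanishes on S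
  and by hypothesis on V; then one factor f is cancelled by primeness and the argument
  repeats.\<close>

lemma van_coeff_of_power_sum:
  assumes f: "f \<in> Pol UNIV" "\<not> van f" "\<And>z. z \<in> S \<Longrightarrow> f z = 0" and "S \<subseteq> V"
  shows "(\<And>l. g l \<in> Pol UNIV) \<Longrightarrow> (\<And>l. (\<forall>z\<in>S. g l z = 0) \<Longrightarrow> van (g l)) \<Longrightarrow>
    van (\<lambda>x. \<Sum>l\<le>L. g l x * f x ^ l) \<Longrightarrow> l \<le> L \<Longrightarrow> van (g l)"
proof (induction L arbitrary: g l)
  case 0
  then show ?case by simp
next
  case (Suc L)
  have split: "(\<Sum>l\<le>Suc L. g l x * f x ^ l) = g 0 x + f x * (\<Sum>l\<le>L. g (Suc l) x * f x ^ l)" for x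
    by (simp only: sum.atMost_Suc_shift sum_distrib_left) (simp add: mult_ac)
  have "g 0 z = 0" if "z \<in> S" for z
  proof -
    have "g 0 z + f z * (\<Sum>l\<le>L. g (Suc l) z * f z ^ l) = 0"
      using Suc.prems(3) that \<open>S \<subseteq> V\<close> unfolding split van_def by blast
    then show ?thesis by (simp add: f(3)[OF that])
  qed
  then have g0: "van (g 0)" using Suc.prems(2) by blast
  then have "van (\<lambda>x. f x * (\<Sum>l\<le>L. g (Suc l) x * f x ^ l))"
    using Suc.prems(3) unfolding split van_def by simp
  moreover have "(\<lambda>x. \<Sum>l\<le>L. g (Suc l) x * f x ^ l) \<in> Pol UNIV"
    by (intro Pol_sum Pol_mult Pol_power Suc.prems(1) f(1))
  ultimately have "van (\<lambda>x. \<Sum>l\<le>L. g (Suc l) x * f x ^ l)"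
    using van_mult[OF f(1)] f(2) by blast
  from Suc.IH[of "\<lambda>l. g (Suc l)", OF Suc.prems(1) Suc.prems(2) this]
  have "van (g (Suc l))" if "l \<le> L" for l using that by simp
  then show ?case using g0 Suc.prems(4) by (cases l) auto
qed

text \<open>With \<open>h z\<close> the Lagrange functions of \<open>S\<close>, the \<open>card S * (L + 1)\<close> functions \<open>h z * f ^ l\<close>, \<open>l \<le> L\<close>, are
  linearly independent on \<open>V\<close>, whereas after clearing denominators they lie in a space whose
  dimension grows like \<open>card box * C * e * L\<close>.\<close>

lemma card_zeros_le:
  assumes f: "f \<in> Pol UNIV" "f \<in> filt e" "\<not> van f" and S: "finite S" "S \<subseteq> {x \<in> V. f x = 0}"
  shows "card S \<le> card box * C * e"
proof (rule ccontr)
  assume "\<not> ?thesis"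
  then have large: "card box * C * e + 1 \<le> card S" by simp
  have "\<exists>h. h \<in> Pol UNIV \<and> h z \<noteq> 0 \<and> (\<forall>y\<in>S - {z}. h y = 0)" for z
    using Pol_separate_points[OF S(1), of z] by metis
  then obtain h where h: "\<And>z. h z \<in> Pol UNIV" "\<And>z. h z z \<noteq> 0" "\<And>z y. y \<in> S - {z} \<Longrightarrow> h z y = 0" by metis
  have "\<exists>e. h z \<in> filt e" for z
  proof -
    obtain e where "\<And>u. (\<lambda>x. h z (x - u)) \<in> filt e" using filt_translates[OF h(1)[of z]] by blast
    from this[of 0] show ?thesis by auto
  qed
  then obtain e1 where e1: "\<And>z. h z \<in> filt (e1 z)" by metis
  define e0 where "e0 = (\<Sum>z\<in>S. e1 z)"
  have e0: "h z \<in> filt e0" if "z \<in> S" for z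
    using filt_le[OF e1[of z]] member_le_sum[of z S e1] that S(1) unfolding e0_def by simp
  \<comment> \<open>Chosen for the count below: with E = e0 + e * L, the number card box * (C * E +
    1) of coefficients equals L + card box * C * e * L, which is less than (card box * C * e + 1) *
    (L + 1).\<close>
  define L where "L = card box * (C * e0 + 1)"
  define E where "E = e0 + e * L"
  have one: "(\<lambda>_. 1) \<in> lat 0"
    using lat_mon[of "\<lambda>_. 0"] D_pos by (simp add: box_iff mon_def[abs_def])
  define repr where "repr z l q \<longleftrightarrow> (\<forall>\<beta>\<in>box. degree (q \<beta>) \<le> C * E) \<and>
    (\<forall>x\<in>V. poly denom (x $ i) ^ E * (h z x * f x ^ l) = (\<Sum>\<beta>\<in>box. poly (q \<beta>) (x $ i) * mon \<beta> x))"
    for z l q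
  have "\<exists>q. repr z l q" if "z \<in> S" "l \<le> L" for z l
  proof -
    have "(\<lambda>x. f x ^ l) \<in> filt (e * L)" using filt_le[OF filt_power[OF f(2)]] that by simp
    from filtD[OF filt_mult[OF e0[OF that(1)] this] one] show ?thesis by (simp add: lat_def E_def repr_def)
  qed
  then obtain q where "\<And>z l. z \<in> S \<Longrightarrow> l \<le> L \<Longrightarrow> repr z l (q z l)" by metis
  then have q_deg: "\<And>z l \<beta>. z \<in> S \<Longrightarrow> l \<le> L \<Longrightarrow> \<beta> \<in> box \<Longrightarrow> degree (q z l \<beta>) \<le> C * E"
    and q: "\<And>z l x. z \<in> S \<Longrightarrow> l \<le> L \<Longrightarrow> x \<in> V \<Longrightarrow> poly denom (x $ i) ^ E * (h z x * f x ^ l)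
      = (\<Sum>\<beta>\<in>box. poly (q z l \<beta>) (x $ i) * mon \<beta> x)"
    unfolding repr_def by blast+
  have "card (box \<times> {..C * E}) < card (S \<times> {..L})"
  proof -
    have "card (box \<times> {..C * E}) = L + card box * C * e * L"
      by (simp add: card_cartesian_product E_def L_def algebra_simps)
    also have "\<dots> < (card box * C * e + 1) * (L + 1)" by (simp add: algebra_simps)
    also have "\<dots> \<le> card S * (L + 1)" using large by (intro mult_right_mono) auto
    finally show ?thesis by (simp add: card_cartesian_product)
  qed
  define T where "T = S \<times> {..L}"
  define Q where "Q s = q (fst s) (snd s)" for s
  have Q_deg: "degree (Q s \<beta>) \<le> C * E" if "s \<in> T" "\<beta> \<in> box" for s \<beta>
    using q_deg that by (auto simp: T_def Q_def)
  have Q: "poly denom (x $ i) ^ E * (h (fst s) x * f x ^ snd s) = (\<Sum>\<beta>\<in>box. poly (Q s \<beta>) (x $ i) * mon \<beta> x)"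
    if "s \<in> T" "x \<in> V" for s x
    using q that by (auto simp: T_def Q_def)
  have "finite T" using S(1) by (simp add: T_def)
  \<comment> \<open>One unknown for each function h z * f ^ l and one equation for each coefficient:
    some nontrivial combination has all its coefficient polynomials equal to zero.\<close>
  have "\<exists>c. (\<exists>s\<in>T. c s \<noteq> 0) \<and>
      (\<forall>b\<in>box \<times> {..C * E}. (\<Sum>s\<in>T. c s * coeff (Q s (fst b)) (snd b)) = 0)"
    using \<open>card (box \<times> {..C * E}) < card (S \<times> {..L})\<close> \<open>finite T\<close> finite_box
    by (intro homogeneous_system) (auto simp only: T_def finite_cartesian_product finite_atMost)
  then obtain c where "\<exists>s\<in>T. c s \<noteq> 0" and
    "\<forall>b\<in>box \<times> {..C * E}. (\<Sum>s\<in>T. c s * coeff (Q s (fst b)) (snd b)) = 0" by blast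
  then have c: "(\<Sum>s\<in>T. c s * coeff (Q s \<beta>) k) = 0" if "\<beta> \<in> box" "k \<le> C * E" for \<beta> k
    using that by force
  note \<open>\<exists>s\<in>T. c s \<noteq> 0\<close>
  then obtain z0 l0 where z0: "z0 \<in> S" "l0 \<le> L" "c (z0, l0) \<noteq> 0" by (auto simp: T_def)
  \<comment> \<open>The combination sorted by powers of f. At a point z of S only the Lagrange
    function of z survives, so g l z determines c (z, l).\<close>
  define g where "g l x = (\<Sum>z\<in>S. c (z, l) * h z x)" for l x
  have g_Pol: "g l \<in> Pol UNIV" for l unfolding g_def by (intro Pol_intros h(1))
  have g_at: "g l z = c (z, l) * h z z" if "z \<in> S" for l z
  proof -
    have "(\<Sum>y\<in>S - {z}. c (y, l) * h y z) = 0" using h(3) that by (intro sum.neutral) auto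
    then show ?thesis unfolding g_def using S(1) that by (simp add: sum.remove[of S z])
  qed
  have combination: "van (\<lambda>x. poly denom (x $ i) ^ E * (\<Sum>l\<le>L. g l x * f x ^ l))"
    unfolding van_def
  proof
    fix x assume x: "x \<in> V"
    have comb: "(\<Sum>s\<in>T. c s * poly (Q s \<beta>) (x $ i)) = 0" if \<beta>: "\<beta> \<in> box" for \<beta>
    proof -
      have "poly (Q s \<beta>) (x $ i) = (\<Sum>k<Suc (C * E). coeff (Q s \<beta>) k * x $ i ^ k)" if "s \<in> T" for s
        using Q_deg[OF that \<beta>] by (intro poly_eq_sum_lessThan coeff_eq_0) auto
      then have "(\<Sum>s\<in>T. c s * poly (Q s \<beta>) (x $ i))
          = (\<Sum>s\<in>T. \<Sum>k\<le>C * E. c s * coeff (Q s \<beta>) k * x $ i ^ k)"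
        by (intro sum.cong refl) (simp only: lessThan_Suc_atMost sum_distrib_left mult.assoc)
      also have "\<dots> = (\<Sum>k\<le>C * E. (\<Sum>s\<in>T. c s * coeff (Q s \<beta>) k) * x $ i ^ k)"
        unfolding sum_distrib_right by (rule sum.swap)
      also have "\<dots> = 0" using c[OF \<beta>] by simp
      finally show ?thesis .
    qed
    have "(\<Sum>l\<le>L. g l x * f x ^ l) = (\<Sum>l\<le>L. \<Sum>z\<in>S. c (z, l) * (h z x * f x ^ l))"
      unfolding g_def sum_distrib_right by (simp only: mult.assoc)
    also have "\<dots> = (\<Sum>z\<in>S. \<Sum>l\<le>L. c (z, l) * (h z x * f x ^ l))" by (rule sum.swap)
    also have "\<dots> = (\<Sum>s\<in>T. c s * (h (fst s) x * f x ^ snd s))"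
      unfolding T_def by (simp add: sum.cartesian_product split_def)
    finally have "poly denom (x $ i) ^ E * (\<Sum>l\<le>L. g l x * f x ^ l)
        = (\<Sum>s\<in>T. c s * (poly denom (x $ i) ^ E * (h (fst s) x * f x ^ snd s)))"
      by (simp add: sum_distrib_left mult_ac)
    also have "\<dots> = (\<Sum>s\<in>T. \<Sum>\<beta>\<in>box. c s * poly (Q s \<beta>) (x $ i) * mon \<beta> x)"
      using Q x by (intro sum.cong refl) (simp add: sum_distrib_left mult.assoc)
    also have "\<dots> = (\<Sum>\<beta>\<in>box. (\<Sum>s\<in>T. c s * poly (Q s \<beta>) (x $ i)) * mon \<beta> x)"
      unfolding sum_distrib_right by (rule sum.swap)
    also have "\<dots> = 0" by (simp add: comb)
    finally show "poly denom (x $ i) ^ E * (\<Sum>l\<le>L. g l x * f x ^ l) = 0" .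
  qed
  \<comment> \<open>The denominator is a nonzero polynomial in x_i, so by \<open>trans\<close> it
    does not vanish identically on V and can be cancelled.\<close>
  have "\<not> van (\<lambda>x. poly denom (x $ i))"
    using trans[of denom] a_nonzero by (auto simp: denom_def)
  moreover have "(\<lambda>x. poly denom (x $ i)) \<in> Pol UNIV" by (intro Pol_poly Pol_var) simp
  moreover have "(\<lambda>x. \<Sum>l\<le>L. g l x * f x ^ l) \<in> Pol UNIV"
    by (intro Pol_sum Pol_mult Pol_power g_Pol f(1))
  ultimately have "van (\<lambda>x. \<Sum>l\<le>L. g l x * f x ^ l)"
    using van_power_mult[OF _ _ combination] by blast
  then have "van (g l0)"
  proof (rule van_coeff_of_power_sum[OF f(1,3), rotated 4])
    show "van (g l)" if "\<forall>z\<in>S. g l z = 0" for l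
    proof -
      have "c (z, l) = 0" if "z \<in> S" for z using g_at[OF that, of l] \<open>\<forall>z\<in>S. g l z = 0\<close> that h(2) by auto
      then show ?thesis by (simp add: van_def g_def)
    qed
  qed (use S g_Pol z0 in auto)
  then have "g l0 z0 = 0" using z0 S by (auto simp: van_def)
  then show False using g_at[OF z0(1)] h(2) z0(3) by simp
qed

end

section \<open>Translates of a curve\<close>

lemma zariski_closed_singleton: "zariski_closed {a :: 'k::field ^ 'm::finite}"
proof -
  have "zariski_closed {x. \<forall>p\<in>range (\<lambda>i x. x $ i - a $ i). p x = 0}"
    by (rule zariski_closed_zeros) (auto intro!: Pol_intros)
  also have "{x. \<forall>p\<in>range (\<lambda>i x. x $ i - a $ i). p x = 0} = {a}" by (auto simp: vec_eq_iff)
  finally show ?thesis .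
qed

lemma irreducible_variety_singleton: "irreducible_variety {a :: 'k::field ^ 'm::finite}"
  unfolding irreducible_variety_def
proof (intro conjI allI impI zariski_closed_singleton)
  fix A B :: "('k ^ 'm) set"
  assume "zariski_closed A \<and> zariski_closed B \<and> {a} = A \<union> B"
  then have "A \<union> B = {a}" by simp
  then show "{a} = A \<or> {a} = B" by (auto simp only: Un_singleton_iff)
qed simp

text \<open>The parameter t can be recovered from a coordinate i with v $ i \<noteq> 0; substituting
  it into the other coordinates gives affine linear equations.\<close>

lemma zariski_closed_line:
  fixes v :: "'k::field ^ 'm::finite"
  assumes "v \<noteq> 0"
  shows "zariski_closed {a + t *s v | t. True}"
proof -
  obtain i where i: "v $ i \<noteq> 0" using assms by (auto simp: vec_eq_iff)
  define e where "e j x = x $ j - (a $ j + (x $ i - a $ i) * inverse (v $ i) * v $ j)" for j and x :: "'k ^ 'm"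
  have "{a + t *s v | t. True} = {x. \<forall>p\<in>range e. p x = 0}"
  proof (intro equalityI subsetI)
    fix x assume "x \<in> {x. \<forall>p\<in>range e. p x = 0}"
    then have "e j x = 0" for j by auto
    then have "x $ j = a $ j + (x $ i - a $ i) * inverse (v $ i) * v $ j" for j
      unfolding e_def by (rule eq_iff_diff_eq_0[THEN iffD2])
    then have "x = a + ((x $ i - a $ i) * inverse (v $ i)) *s v"
      unfolding vec_eq_iff vector_add_component vector_smult_component by (rule allI)
    then show "x \<in> {a + t *s v | t. True}" by blast
  qed (use i in \<open>auto simp: e_def\<close>)
  moreover have "e j \<in> Pol UNIV" for j
    unfolding e_def by (intro Pol_diff Pol_add Pol_mult Pol_const Pol_var UNIV_I)
  then have "range e \<subseteq> Pol UNIV" by (rule image_subsetI)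
  then have "zariski_closed {x. \<forall>p\<in>range e. p x = 0}" by (rule zariski_closed_zeros)
  ultimately show ?thesis by (simp only:)
qed

lemma zariski_closed_contains_line:
  fixes v :: "'k::field ^ 'm::finite"
  assumes X: "zariski_closed X" and inf: "infinite {s. a + s *s v \<in> X}"
  shows "a + s *s v \<in> X"
proof (rule ccontr)
  assume "a + s *s v \<notin> X"
  from zariski_closed_separate[OF X this] obtain f where f: "f \<in> Pol UNIV" "\<forall>y\<in>X. f y = 0" "f (a + s *s v) \<noteq> 0"
    by blast
  have "infinite {s. f (a + s *s v) = 0}"
    by (rule infinite_super[OF _ inf]) (use f(2) in auto)
  from Pol_zero_on_line[OF f(1) this] f(3) show False by blast
qed

text \<open>The field is infinite, so one of two closed parts contains infinitely many points of the
  line and therefore all of it.\<close>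

lemma irreducible_variety_line:
  fixes v :: "'k::field_char_0 ^ 'm::finite"
  assumes "v \<noteq> 0"
  shows "irreducible_variety {a + t *s v | t. True}"
  unfolding irreducible_variety_def
proof (intro conjI allI impI)
  show "zariski_closed {a + t *s v | t. True}" by (rule zariski_closed_line[OF assms])
  fix A B :: "('k ^ 'm) set"
  assume *: "zariski_closed A \<and> zariski_closed B \<and> {a + t *s v | t. True} = A \<union> B"
  then have "UNIV = {s. a + s *s v \<in> A} \<union> {s. a + s *s v \<in> B}" by blast
  then have "infinite {s. a + s *s v \<in> A} \<or> infinite {s. a + s *s v \<in> B}"
    using infinite_UNIV_char_0[where 'a = 'k] by (metis finite_UnI)
  then show "{a + t *s v | t. True} = A \<or> {a + t *s v | t. True} = B"
  proof
    assume "infinite {s. a + s *s v \<in> A}"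
    then have "a + s *s v \<in> A" for s using * zariski_closed_contains_line by blast
    then show ?thesis using * by blast
  next
    assume "infinite {s. a + s *s v \<in> B}"
    then have "a + s *s v \<in> B" for s using * zariski_closed_contains_line by blast
    then show ?thesis using * by blast
  qed
qed auto

lemma variety_dim_1_no_chain:
  assumes "variety_dim V = 1" "irreducible_variety X" "irreducible_variety Y" "irreducible_variety Z"
    and "X \<subset> Y" "Y \<subset> Z" "Z \<subseteq> V"
  shows False
proof -
  define C where "C n = (if n = 0 then X else if n = 1 then Y else Z)" for n :: nat
  have "(\<forall>i\<le>2. irreducible_variety (C i) \<and> C i \<subseteq> V) \<and> (\<forall>i<2. C i \<subset> C (Suc i))"
    using assms by (auto simp: C_def less_2_cases_iff)
  then have "enat 2 \<le> variety_dim V" unfolding variety_dim_def by (intro Sup_upper) blast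
  then show False using assms(1) by (simp add: one_enat_def)
qed

section \<open>Finiteness and uniform bounds on a curve\<close>

locale curve =
  fixes V :: "('k::{alg_closed_field, field_char_0} ^ 'm::finite) set"
  assumes irreducible: "irreducible_variety V" and dim: "variety_dim V = 1"
begin

lemma closed: "zariski_closed V"
  using irreducible by (simp add: irreducible_variety_def)

sublocale prime_locus V
proof
  fix f g :: "'k ^ 'm \<Rightarrow> 'k"
  assume f: "f \<in> Pol UNIV" and g: "g \<in> Pol UNIV" and fg: "\<forall>x\<in>V. f x * g x = 0"
  have "V = (V \<inter> {x. f x = 0}) \<union> (V \<inter> {x. g x = 0})" using fg by auto
  moreover have "zariski_closed (V \<inter> {x. f x = 0})" "zariski_closed (V \<inter> {x. g x = 0})"
    by (intro zariski_closed_Int closed zariski_closed_zero f g)+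
  ultimately have "V = V \<inter> {x. f x = 0} \<or> V = V \<inter> {x. g x = 0}"
    using irreducible unfolding irreducible_variety_def by blast
  then show "(\<forall>x\<in>V. f x = 0) \<or> (\<forall>x\<in>V. g x = 0)" by blast
qed

text \<open>A minimal infinite closed subset Y of X is irreducible: in any decomposition one part is
  infinite, hence equal to Y. A point of Y, Y itself and V would then form a chain of length
  2.\<close>

lemma finite_proper_closed:
  assumes "zariski_closed X" "X \<subset> V"
  shows "finite X"
proof (rule ccontr)
  assume "infinite X"
  then obtain Y where Y: "zariski_closed Y" "infinite Y" "Y \<subseteq> X"
    "\<And>Z. zariski_closed Z \<Longrightarrow> infinite Z \<Longrightarrow> Z \<subseteq> Y \<Longrightarrow> Z = Y"
    using zariski_closed_minimal[of X infinite] assms(1) by blast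
  obtain y where "y \<in> Y" using infinite_imp_nonempty[OF Y(2)] by blast
  moreover have "{y} \<noteq> Y" using Y(2) by auto
  ultimately have "{y} \<subset> Y" by blast
  have "Y = A \<or> Y = B" if "zariski_closed A" "zariski_closed B" "Y = A \<union> B" for A B
  proof -
    have "infinite A \<or> infinite B" using Y(2) that(3) by auto
    then show ?thesis using Y(4)[OF that(1)] Y(4)[OF that(2)] that(3) by blast
  qed
  then have "irreducible_variety Y" using Y(1) \<open>y \<in> Y\<close> unfolding irreducible_variety_def by blast
  from variety_dim_1_no_chain[OF dim irreducible_variety_singleton this irreducible \<open>{y} \<subset> Y\<close>]
  show False using Y(3) assms(2) by blast
qed

lemma affine_line_if_translate:
  assumes "u \<noteq> 0" and sub: "V \<subseteq> (+) u ` V"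
  shows "affine_line V"
proof -
  obtain a where a: "a \<in> V" using irreducible unfolding irreducible_variety_def by blast
  have step: "x - u \<in> V" if "x \<in> V" for x using sub that by auto
  have "a + (- of_nat n) *s u \<in> V" for n
  proof (induction n)
    case (Suc n)
    have "a + (- of_nat (Suc n)) *s u = (a + (- of_nat n) *s u) - u"
      by (simp add: vec_eq_iff algebra_simps)
    then show ?case using step[OF Suc.IH] by (simp only:)
  qed (use a in simp)
  then have "range (\<lambda>n. - of_nat n) \<subseteq> {s. a + s *s u \<in> V}" by blast
  moreover have "inj (\<lambda>n. - of_nat n :: 'k)" by (rule injI) simp
  ultimately have "infinite {s. a + s *s u \<in> V}" using range_inj_infinite infinite_super by blast
  then have line: "a + s *s u \<in> V" for s by (rule zariski_closed_contains_line[OF closed])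
  define L where "L = {a + s *s u | s. True}"
  have L: "a + s *s u \<in> L" for s unfolding L_def by blast
  have "L \<subseteq> V" using line unfolding L_def by blast
  have "a \<in> L" "a + u \<in> L" "a + u \<noteq> a" using L[of 0] L[of 1] \<open>u \<noteq> 0\<close> by simp_all
  then have "{a} \<subset> L" by blast
  have "irreducible_variety L" unfolding L_def by (rule irreducible_variety_line[OF \<open>u \<noteq> 0\<close>])
  from variety_dim_1_no_chain[OF dim irreducible_variety_singleton this irreducible \<open>{a} \<subset> L\<close>]
  have "V = L" using \<open>L \<subseteq> V\<close> by blast
  then show ?thesis unfolding affine_line_def L_def using \<open>u \<noteq> 0\<close> by blast
qed

lemma translate_intersection_bounded:
  assumes "\<not> affine_line V"
  shows "\<exists>N. \<forall>u. u \<noteq> 0 \<longrightarrow> finite (V \<inter> (+) u ` V) \<and> card (V \<inter> (+) u ` V) \<le> N"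
proof (cases "finite V")
  case True
  then show ?thesis by (intro exI[of _ "card V"]) (auto intro: card_mono)
next
  case False
  obtain x where "x \<in> V" using infinite_imp_nonempty[OF False] by blast
  moreover obtain y where "y \<in> V - {x}" using infinite_imp_nonempty[OF infinite_remove[OF False]] by blast
  ultimately have xy: "x \<in> V" "y \<in> V" "x \<noteq> y" by auto
  \<comment> \<open>A coordinate that is not constant on V serves as parameter: a relation q(x_i) =
    0 would cover V by finitely many finite fibres.\<close>
  then obtain i where i: "x $ i \<noteq> y $ i" by (auto simp: vec_eq_iff)
  have fibre: "finite {x \<in> V. x $ j = c}" if "\<not> van (\<lambda>x. x $ j - c)" for j c
  proof (rule finite_proper_closed)
    have "zariski_closed {x. x $ j - c = 0}" by (intro zariski_closed_zero Pol_intros) simp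
    from zariski_closed_Int[OF closed this] show "zariski_closed {x \<in> V. x $ j = c}"
      by (simp add: Int_def)
    show "{x \<in> V. x $ j = c} \<subset> V" using that by (auto simp: van_def)
  qed
  have trans: "q = 0" if "van (\<lambda>x. poly q (x $ i))" for q
  proof (rule ccontr)
    assume "q \<noteq> 0"
    have "finite {x \<in> V. x $ i = c}" for c
    proof (rule fibre)
      have "x $ i \<noteq> c \<or> y $ i \<noteq> c" using i by auto
      then show "\<not> van (\<lambda>x. x $ i - c)" using xy by (auto simp: van_def)
    qed
    then have "finite (\<Union>c\<in>{c. poly q c = 0}. {x \<in> V. x $ i = c})"
      using poly_roots_finite[OF \<open>q \<noteq> 0\<close>] by blast
    moreover have "V \<subseteq> (\<Union>c\<in>{c. poly q c = 0}. {x \<in> V. x $ i = c})" using that by (auto simp: van_def)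
    ultimately show False using False finite_subset by blast
  qed
  define rel where "rel j D a p \<longleftrightarrow> D > 0 \<and> a \<noteq> 0 \<and>
      (\<forall>x\<in>V. poly a (x $ i) * x $ j ^ D = (\<Sum>l<D. poly (p l) (x $ i) * x $ j ^ l))" for j D a p
  have "\<exists>D a p. rel j D a p" for j
    unfolding rel_def by (rule coordinate_relation[OF closed False fibre trans])
  then obtain D a p where rel: "\<And>j. rel j (D j) (a j) (p j)" by metis
  interpret curve_relations V i D a p
  proof
    show "q = 0" if "van (\<lambda>x. poly q (x $ i))" for q using trans that by blast
    show "D j > 0" "a j \<noteq> 0" for j using rel[of j] by (simp_all add: rel_def)
    show "poly (a j) (x $ i) * x $ j ^ D j = (\<Sum>l<D j. poly (p j l) (x $ i) * x $ j ^ l)"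
      if "x \<in> V" for x j using rel[of j] that by (simp add: rel_def)
  qed
  obtain P where P: "finite P" "P \<subseteq> Pol UNIV" "V = {x. \<forall>p\<in>P. p x = 0}"
    using zariski_closed_finite_zeros[OF closed] .
  define e where "e f = (SOME e. \<forall>u. (\<lambda>x. f (x - u)) \<in> filt e)" for f
  have e: "(\<lambda>x. f (x - u)) \<in> filt (e f)" if "f \<in> P" for f u
    using someI_ex[OF filt_translates] that P(2) unfolding e_def by blast
  define E where "E = (\<Sum>f\<in>P. e f)"
  have E: "(\<lambda>x. f (x - u)) \<in> filt E" if "f \<in> P" for f u
    using filt_le[OF e[OF that]] member_le_sum[of f P e] that P(1) by (simp add: E_def)
  have "finite (V \<inter> (+) u ` V) \<and> card (V \<inter> (+) u ` V) \<le> card box * C * E" if u: "u \<noteq> 0" for u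
  proof -
    obtain x where x: "x \<in> V" "x \<notin> (+) u ` V"
      using affine_line_if_translate[OF u] assms by blast
    then have "x - u \<notin> V" using imageI[of "x - u" V "(+) u"] by auto
    \<comment> \<open>Which defining polynomial works depends on u; its translate lies in
      \<open>filt E\<close> in any case, so the bound does not depend on u.\<close>
    then obtain f where f: "f \<in> P" "f (x - u) \<noteq> 0" using P(3) by blast
    have bound: "card S \<le> card box * C * E" if "finite S" "S \<subseteq> V \<inter> (+) u ` V" for S
    proof (rule card_zeros_le[OF _ E[OF f(1), of u]])
      show "(\<lambda>x. f (x - u)) \<in> Pol UNIV" using f(1) P(2) by (intro Pol_translate) auto
      show "\<not> van (\<lambda>x. f (x - u))" using x(1) f(2) by (auto simp: van_def)
      have "f y = 0" if "y \<in> V" for y using that f(1) P(3) by blast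
      then show "S \<subseteq> {x \<in> V. f (x - u) = 0}" using that(2) by auto
    qed (rule that)
    \<comment> \<open>The count of zeros applies to finite sets only; bounding all finite subsets
      yields finiteness of the intersection as well.\<close>
    from finite_if_finite_subsets_card_bdd[of "V \<inter> (+) u ` V" "card box * C * E"] bound
    show ?thesis by blast
  qed
  then show ?thesis by blast
qed

end

section \<open>Cliques in the Cayley graph\<close>

lemma complete_subgraph_cayley_graph:
  assumes "subgraph H (with_proj (cayley_graph S))" "complete_digraph n H"
  shows "\<exists>X. finite X \<and> card X = n \<and> (\<forall>x\<in>X. \<forall>y\<in>X. x \<noteq> y \<longrightarrow> x - y \<in> S)"
proof (intro exI[of _ "verts H"] conjI ballI impI)
  from assms(2) have H: "graph H" "card (verts H) = n"
    "arcs_ends H = {(u, v). (u, v) \<in> verts H \<times> verts H \<and> u \<noteq> v}"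
    unfolding complete_digraph_def by auto
  interpret graph H by (rule H(1))
  show "finite (verts H)" "card (verts H) = n" using H(2) by auto
  fix x y assume "x \<in> verts H" "y \<in> verts H" "x \<noteq> y"
  then have "(x, y) \<in> arcs_ends H" using H(3) by auto
  then obtain b where "b \<in> arcs H" "tail H b = x" "head H b = y" by (auto simp: arcs_ends_conv)
  with assms(1) show "x - y \<in> S"
    by (auto simp: subgraph_def compatible_def cayley_graph_def)
qed

lemma finite_card_le_if_image_subset:
  assumes "inj_on f A" "f ` A \<subseteq> B" "finite B \<and> card B \<le> N"
  shows "finite A \<and> card A \<le> N"
  using assms inj_on_finite[of f A B] card_inj_on_le[of f A B] by auto

text \<open>Two of the three signs with which a further vertex is adjacent to three fixed vertices agree.\<close>

lemma card_clique_le: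
  fixes V :: "'a::ab_group_add set"
  assumes N: "\<And>u. u \<noteq> 0 \<Longrightarrow> finite (V \<inter> (+) u ` V) \<and> card (V \<inter> (+) u ` V) \<le> N"
    and X: "finite X" "\<And>x y. x \<in> X \<Longrightarrow> y \<in> X \<Longrightarrow> x \<noteq> y \<Longrightarrow> x - y \<in> pm_set V"
  shows "card X \<le> 3 + 6 * N"
proof (cases "card X < 3")
  case False
  then obtain T where "T \<subseteq> X" "card T = 3" by (metis not_less obtain_subset_with_card_n)
  then obtain a b c where abc: "a \<in> X" "b \<in> X" "c \<in> X" "a \<noteq> b" "a \<noteq> c" "b \<noteq> c"
    by (auto simp: card_3_iff)
  \<comment> \<open>One set for each sign on which two vertices can agree: y \<mapsto> y - a maps
    \<open>P a b\<close> into V \<inter> (V + (b - a)), and y \<mapsto> a - y maps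
    \<open>M a b\<close> into V \<inter> (V + (a - b)).\<close>
  define P where "P a b = {y. y - a \<in> V \<and> y - b \<in> V}" for a b
  define M where "M a b = {y. a - y \<in> V \<and> b - y \<in> V}" for a b
  have P: "finite (P a b) \<and> card (P a b) \<le> N" if "a \<noteq> b" for a b
  proof -
    have "(\<lambda>y. y - a) ` P a b \<subseteq> V \<inter> (+) (b - a) ` V"
    proof
      fix z assume "z \<in> (\<lambda>y. y - a) ` P a b"
      then obtain y where y: "y - a \<in> V" "y - b \<in> V" "z = y - a" by (auto simp: P_def)
      have "z = (b - a) + (y - b)" using y(3) by simp
      then have "z \<in> (+) (b - a) ` V" using y(2) by (rule image_eqI)
      then show "z \<in> V \<inter> (+) (b - a) ` V" using y by simp
    qed
    from finite_card_le_if_image_subset[OF _ this, of N] show ?thesis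
      using N[of "b - a"] that by (simp add: inj_on_def)
  qed
  have M: "finite (M a b) \<and> card (M a b) \<le> N" if "a \<noteq> b" for a b
  proof -
    have "(\<lambda>y. a - y) ` M a b \<subseteq> V \<inter> (+) (a - b) ` V"
    proof
      fix z assume "z \<in> (\<lambda>y. a - y) ` M a b"
      then obtain y where y: "a - y \<in> V" "b - y \<in> V" "z = a - y" by (auto simp: M_def)
      have "z = (a - b) + (b - y)" using y(3) by simp
      then have "z \<in> (+) (a - b) ` V" using y(2) by (rule image_eqI)
      then show "z \<in> V \<inter> (+) (a - b) ` V" using y by simp
    qed
    from finite_card_le_if_image_subset[OF _ this, of N] show ?thesis
      using N[of "a - b"] that by (simp add: inj_on_def)
  qed
  \<comment> \<open>Three pairs of vertices times two signs. The length of the list bounds the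
    number of distinct sets even if some of them coincide.\<close>
  let ?F = "[P a b, P a c, P b c, M a b, M a c, M b c]"
  have "X \<subseteq> {a, b, c} \<union> \<Union> (set ?F)"
  proof
    fix y assume y: "y \<in> X"
    have "y = x \<or> y - x \<in> V \<or> x - y \<in> V" if "x \<in> X" for x
    proof (cases "y = x")
      case False
      have "y - x \<in> V \<or> - (y - x) \<in> V" using X(2)[OF y that False] unfolding pm_set_def by fastforce
      then show ?thesis by simp
    qed blast
    then have "y = a \<or> y - a \<in> V \<or> a - y \<in> V" "y = b \<or> y - b \<in> V \<or> b - y \<in> V"
      "y = c \<or> y - c \<in> V \<or> c - y \<in> V" using abc by blast+
    then show "y \<in> {a, b, c} \<union> \<Union> (set ?F)" by (auto simp: P_def M_def)
  qed
  moreover have "finite (\<Union> (set ?F))" using P M abc by auto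
  ultimately have "card X \<le> card ({a, b, c} \<union> \<Union> (set ?F))" by (intro card_mono) auto
  also have "\<dots> \<le> card {a, b, c} + card (\<Union> (set ?F))" by (rule card_Un_le)
  also have "card (\<Union> (set ?F)) \<le> (\<Sum>Y\<in>set ?F. card Y)" by (rule card_Union_le_sum_card)
  also have "\<dots> \<le> (\<Sum>Y\<in>set ?F. N)" using P M abc by (intro sum_mono) auto
  also have "\<dots> = card (set ?F) * N" by simp
  also have "\<dots> \<le> 6 * N" using card_length[of ?F] by (intro mult_right_mono) auto
  finally show ?thesis using abc by simp
qed simp

theorem theorem1p11:
  fixes V :: "('k :: {alg_closed_field, field_char_0} ^ 'm::finite) set"
  assumes "irreducible_variety V"
    and "variety_dim V = 1"
    and "\<not> affine_line V"
  shows "clique_number (with_proj (cayley_graph (pm_set V))) < \<infinity>"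
proof -
  interpret curve V by unfold_locales (use assms in auto)
  obtain N where N: "\<And>u. u \<noteq> 0 \<Longrightarrow> finite (V \<inter> (+) u ` V) \<and> card (V \<inter> (+) u ` V) \<le> N"
    using translate_intersection_bounded[OF assms(3)] by blast
  have "clique_number (with_proj (cayley_graph (pm_set V))) \<le> enat (3 + 6 * N)"
    unfolding clique_number_def
  proof (rule Sup_least)
    fix m assume "m \<in> {enat n | n. \<exists>H. subgraph H (with_proj (cayley_graph (pm_set V))) \<and> complete_digraph n H}"
    then obtain n H where n: "m = enat n" and
      "subgraph H (with_proj (cayley_graph (pm_set V)))" "complete_digraph n H" by blast
    from complete_subgraph_cayley_graph[OF this(2,3)] obtain X where
      X: "finite X" "card X = n" "\<And>x y. x \<in> X \<Longrightarrow> y \<in> X \<Longrightarrow> x \<noteq> y \<Longrightarrow> x - y \<in> pm_set V" by blast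
    from card_clique_le[OF N X(1,3)] show "m \<le> enat (3 + 6 * N)" by (simp add: n X(2))
  qed
  then show ?thesis by (rule order.strict_trans1) simp
qed

end
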